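(* Let $L\in\{1,\infty\}$, let $\rho$ be a function quasi-norm on $(0,L)$, and let $B$ and $E$ be the corresponding quasi-Banach function space and rearrangement-invariant (r.i.) quasi-Banach function space, with $\|f\|_B=\rho(|f|)$ and $\|f\|_E=\rho(f^* )$, and Boyd indices $p_E,q_E$ of $E$. Let $0<W<\infty$. (i) Let $0<U<\infty$. Then $$\|f\|_E\sim\|H^{(U,W)}f\|_B\ \text{ for all } f\in\mathfrak M(0,L)\quad\text{if and only if}\quad p_E>U.$$ In particular, $\|f\|_E\sim\|f^{**}_{(U)}\|_B$ (for all $f\in\mathfrak M(0,L)$) if and only if $p_E>U$, and $\|f\|_E\sim\|f^{**}\|_B$ (for all $f\in\mathfrak M(0,L)$) if and only if $p_E>1$. (ii) Let $0<V\le\infty$. Then $$\|f\|_E\sim\|H_{(V,W)}f\|_B\ \text{ for all } f\in\mathfrak M(0,L)\quad\text{if and only if}\quad q_E<V.$$ In particular, $\|f\|_E\sim\big\|t^{-1}\int_t^\infty f^*(s)\,ds\big\|_B$ (for all $f\in\mathfrak M(0,L)$) if and only if $q_E<1$.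
   Context: Conventions: $1/\infty=0$. $\mathfrak M(0,L)$ is the set of complex-valued Lebesgue measurable a.e. finite functions on $(0,L)$ (identified if equal a.e.), $\mathfrak M^+(0,L)$ its subset of non-negative functions. For $0<q\le\infty$, $\|\cdot\|_{q,(a,b)}$ is the usual Lebesgue (quasi-)norm on $(a,b)$. $f^*(t)=\inf\{\lambda>0:\ |\{x\in(0,L):|f(x)|>\lambda\}|\le t\}$, $t>0$, is the non-increasing rearrangement (so $f^*(t)=0$ for $t\geq L$ if $L=1$). $F\sim G$ means $c\,G\le F\le C\,G$ with constants $0<c\le C<\infty$ independent of $f$ (both sides may be $\infty$). Function quasi-norm: a map $\rho:\mathfrak M^+(0,L)\to[0,\infty]$ for which there is $C_\rho\ge1$ such that for $f,g,f_n\in\mathfrak M^+(0,L)$, $\lambda\ge0$: (P1) $\rho(f)=0\Leftrightarrow f=0$ a.e., $\rho(\lambda f)=\lambda\rho(f)$, $\rho(f+g)\le C_\rho(\rho(f)+\rho(g))$; (P2) $g\le f$ a.e. implies $\rho(g)\le\rho(f)$; (P3) $0\le f_n\nearrow f$ a.e. and $\sup_n\rho(f_n)<\infty$ imply $\rho(f)<\infty$ and $\rho(f_n)\nearrow\rho(f)$; (P4-weak) $\rho(\chi_\omega)<\infty$ for every bounded measurable $\omega\subset(0,L)$. $B=\{f\in\mathfrak M(0,L):\|f\|_B:=\rho(|f|)<\infty\}$ and $E=\{f\in\mathfrak M(0,L):\|f\|_E:=\rho(f^* )<\infty\}$; $E$ is called an r.i. quasi-Banach function space (it is understood that $f\mapsto\rho(f^*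 )$ is a quasi-norm on $E$; then the dilation operators below are bounded on $E$). If a $[0,\infty]$-valued measurable function $g$ is infinite on a set of positive measure, $\|g\|_B:=\infty$ and likewise $\rho(g):=\infty$. Dilations: $(D_af)(t)=f(at)\chi_{(0,L)}(at)$, $a>0$, $0<t<L$; $\|D_a\|$ is the norm of $D_a:E\to E$. Boyd indices: $p_E=\sup\{p>0:\exists c>0\ \forall\,0<a<1\ \|D_a\|\le c\,a^{-1/p}\}$, $q_E=\inf\{q>0:\exists c>0\ \forall a\ge1\ \|D_a\|\le c\,a^{-1/q}\}$ ($\inf\emptyset=\infty$); $0<p_E\le q_E\le\infty$. Averaging operators, for $f\in\mathfrak M(0,L)$, $t\in(0,L)$: $$(H^{(U,W)}f)(t)=t^{-1/U}\big\|v^{\frac1U-\frac1W}f^*(v)\big\|_{W,(0,t)},\qquad (H_{(V,W)}f)(t)=t^{-1/V}\big\|v^{\frac1V-\frac1W}f^*(v)\big\|_{W,(t,L)}.$$ $f^{**}(t)=\frac1t\int_0^tf^*(u)\,du$ and $f^{**}_{(U)}(t)=\big(t^{-1}\int_0^tf^*(v)^U\,dv\big)^{1/U}$. *)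

theory Defs
  imports "HOL-Analysis.Analysis"
begin

text \<open>
  The underlying interval is \<open>(0,L)\<close>, with \<open>L\<close> an extended non-negative number.  Functions are
  total on \<^typ>\<open>real\<close>; only their values on \<open>(0,L)\<close>, and these only up to null sets, are relevant.
\<close>

definition dom :: "ennreal \<Rightarrow> real set" where
  "dom L = {t. 0 < t \<and> ennreal t < L}"

definition Mfun :: "ennreal \<Rightarrow> (real \<Rightarrow> complex) set" where
  "Mfun L = borel_measurable (lebesgue_on (dom L))"

definition Mplus :: "ennreal \<Rightarrow> (real \<Rightarrow> ennreal) set" where
  "Mplus L = {f \<in> borel_measurable (lebesgue_on (dom L)). AE x in lebesgue_on (dom L). f x < \<infinity>}"

text \<open>
  No separate axiom is needed for the identification of functions that agree almost everywhere:
  monotonicity is stated almost everywhere, so \<open>\<rho>\<close> is constant on equivalence classes.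
\<close>

definition function_quasi_norm :: "ennreal \<Rightarrow> ((real \<Rightarrow> ennreal) \<Rightarrow> ennreal) \<Rightarrow> bool" where
  "function_quasi_norm L \<rho> \<longleftrightarrow>
     (\<forall>f\<in>Mplus L. \<rho> f = 0 \<longleftrightarrow> (AE x in lebesgue_on (dom L). f x = 0)) \<and>
     (\<forall>f\<in>Mplus L. \<forall>c::real. 0 \<le> c \<longrightarrow> \<rho> (\<lambda>x. ennreal c * f x) = ennreal c * \<rho> f) \<and>
     (\<exists>C::real. 1 \<le> C \<and>
        (\<forall>f\<in>Mplus L. \<forall>g\<in>Mplus L. \<rho> (\<lambda>x. f x + g x) \<le> ennreal C * (\<rho> f + \<rho> g))) \<and>
     (\<forall>f\<in>Mplus L. \<forall>g\<in>Mplus L.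
        (AE x in lebesgue_on (dom L). g x \<le> f x) \<longrightarrow> \<rho> g \<le> \<rho> f) \<and>
     (\<forall>F f. (\<forall>n::nat. F n \<in> Mplus L) \<longrightarrow> f \<in> Mplus L \<longrightarrow>
        (AE x in lebesgue_on (dom L). incseq (\<lambda>n. F n x) \<and> (\<lambda>n. F n x) \<longlonglongrightarrow> f x) \<longrightarrow>
        (SUP n. \<rho> (F n)) < \<infinity> \<longrightarrow>
        \<rho> f < \<infinity> \<and> incseq (\<lambda>n. \<rho> (F n)) \<and> (\<lambda>n. \<rho> (F n)) \<longlonglongrightarrow> \<rho> f) \<and>
     (\<forall>\<omega>. \<omega> \<in> sets lebesgue \<longrightarrow> bounded \<omega> \<longrightarrow> \<omega> \<subseteq> dom L \<longrightarrow> \<rho> (indicator \<omega>) < \<infinity>)"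

text \<open>
  The functional \<open>\<parallel>\<cdot>\<parallel>\<^sub>B\<close> on \<open>[0,\<infinity>]\<close>-valued measurable functions: the value is \<open>\<infinity>\<close> by convention
  if the function is infinite on a set of positive measure.
\<close>

definition B_norm :: "ennreal \<Rightarrow> ((real \<Rightarrow> ennreal) \<Rightarrow> ennreal) \<Rightarrow> (real \<Rightarrow> ennreal) \<Rightarrow> ennreal" where
  "B_norm L \<rho> g = (if AE x in lebesgue_on (dom L). g x < \<infinity> then \<rho> g else \<infinity>)"

text \<open>The value is \<open>\<infinity>\<close> (the infimum of the empty set) if no level \<open>l\<close> is admissible.\<close>

definition rearr :: "ennreal \<Rightarrow> (real \<Rightarrow> complex) \<Rightarrow> real \<Rightarrow> ennreal" where
  "rearr L f t =
     Inf {ennreal l | l. 0 < l \<and> emeasure lebesgue {x \<in> dom L. cmod (f x) > l} \<le> ennreal t}"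

definition E_norm :: "ennreal \<Rightarrow> ((real \<Rightarrow> ennreal) \<Rightarrow> ennreal) \<Rightarrow> (real \<Rightarrow> complex) \<Rightarrow> ennreal" where
  "E_norm L \<rho> f = B_norm L \<rho> (rearr L f)"

definition E_space :: "ennreal \<Rightarrow> ((real \<Rightarrow> ennreal) \<Rightarrow> ennreal) \<Rightarrow> (real \<Rightarrow> complex) set" where
  "E_space L \<rho> = {f \<in> Mfun L. E_norm L \<rho> f < \<infinity>}"

definition E_quasi_norm :: "ennreal \<Rightarrow> ((real \<Rightarrow> ennreal) \<Rightarrow> ennreal) \<Rightarrow> bool" where
  "E_quasi_norm L \<rho> \<longleftrightarrow>
     (\<forall>f\<in>E_space L \<rho>. E_norm L \<rho> f = 0 \<longleftrightarrow> (AE x in lebesgue_on (dom L). f x = 0)) \<and>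
     (\<forall>f\<in>E_space L \<rho>. \<forall>c::complex.
        E_norm L \<rho> (\<lambda>x. c * f x) = ennreal (cmod c) * E_norm L \<rho> f) \<and>
     (\<exists>C::real. 1 \<le> C \<and> (\<forall>f\<in>E_space L \<rho>. \<forall>g\<in>E_space L \<rho>.
        E_norm L \<rho> (\<lambda>x. f x + g x) \<le> ennreal C * (E_norm L \<rho> f + E_norm L \<rho> g)))"

definition dil :: "ennreal \<Rightarrow> real \<Rightarrow> (real \<Rightarrow> complex) \<Rightarrow> real \<Rightarrow> complex" where
  "dil L a f t = (if a * t \<in> dom L then f (a * t) else 0)"

definition dil_norm :: "ennreal \<Rightarrow> ((real \<Rightarrow> ennreal) \<Rightarrow> ennreal) \<Rightarrow> real \<Rightarrow> ennreal" where
  "dil_norm L \<rho> a = (SUP f\<in>{f \<in> E_space L \<rho>. E_norm L \<rho> f \<le> 1}. E_norm L \<rho> (dil L a f))"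

definition boyd_p :: "ennreal \<Rightarrow> ((real \<Rightarrow> ennreal) \<Rightarrow> ennreal) \<Rightarrow> ennreal" where
  "boyd_p L \<rho> = Sup {ennreal p | p. 0 < p \<and>
     (\<exists>c>0. \<forall>a. 0 < a \<and> a < 1 \<longrightarrow> dil_norm L \<rho> a \<le> ennreal (c * a powr (- 1 / p)))}"

definition boyd_q :: "ennreal \<Rightarrow> ((real \<Rightarrow> ennreal) \<Rightarrow> ennreal) \<Rightarrow> ennreal" where
  "boyd_q L \<rho> = Inf {ennreal q | q. 0 < q \<and>
     (\<exists>c>0. \<forall>a\<ge>1. dil_norm L \<rho> a \<le> ennreal (c * a powr (- 1 / q)))}"

text \<open>Only meant for exponents \<open>r > 0\<close>.\<close>

definition epowr :: "ennreal \<Rightarrow> real \<Rightarrow> ennreal" where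
  "epowr x r = (if x = \<infinity> then \<infinity> else ennreal (enn2real x powr r))"

definition Lq_norm :: "real \<Rightarrow> real set \<Rightarrow> (real \<Rightarrow> ennreal) \<Rightarrow> ennreal" where
  "Lq_norm q A g = epowr (\<integral>\<^sup>+v\<in>A. epowr (g v) q \<partial>lebesgue) (1 / q)"

definition H_upper :: "ennreal \<Rightarrow> real \<Rightarrow> real \<Rightarrow> (real \<Rightarrow> complex) \<Rightarrow> real \<Rightarrow> ennreal" where
  "H_upper L U W f t = ennreal (t powr (- 1 / U)) *
     Lq_norm W {0<..<t} (\<lambda>v. ennreal (v powr (1 / U - 1 / W)) * rearr L f v)"

text \<open>\<open>V\<close> may be \<open>\<infinity>\<close>; note that \<open>1 / \<infinity> = 0\<close> in \<^typ>\<open>ennreal\<close>.\<close>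

definition H_lower :: "ennreal \<Rightarrow> ennreal \<Rightarrow> real \<Rightarrow> (real \<Rightarrow> complex) \<Rightarrow> real \<Rightarrow> ennreal" where
  "H_lower L V W f t = ennreal (t powr (- enn2real (1 / V))) *
     Lq_norm W {v. t < v \<and> ennreal v < L}
       (\<lambda>v. ennreal (v powr (enn2real (1 / V) - 1 / W)) * rearr L f v)"

definition maximal_fn :: "ennreal \<Rightarrow> (real \<Rightarrow> complex) \<Rightarrow> real \<Rightarrow> ennreal" where
  "maximal_fn L f t = ennreal (1 / t) * (\<integral>\<^sup>+u\<in>{0<..<t}. rearr L f u \<partial>lebesgue)"

definition maximal_fn_pow :: "ennreal \<Rightarrow> real \<Rightarrow> (real \<Rightarrow> complex) \<Rightarrow> real \<Rightarrow> ennreal" where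
  "maximal_fn_pow L U f t =
     epowr (ennreal (1 / t) * (\<integral>\<^sup>+v\<in>{0<..<t}. epowr (rearr L f v) U \<partial>lebesgue)) (1 / U)"

definition norm_equiv ::
  "ennreal \<Rightarrow> ((real \<Rightarrow> complex) \<Rightarrow> ennreal) \<Rightarrow> ((real \<Rightarrow> complex) \<Rightarrow> ennreal) \<Rightarrow> bool" where
  "norm_equiv L F G \<longleftrightarrow> (\<exists>c C::real. 0 < c \<and> c \<le> C \<and>
     (\<forall>f\<in>Mfun L. ennreal c * G f \<le> F f \<and> F f \<le> ennreal C * G f))"

end

theory Submission
  imports Defs
begin

text \<open>
  Everything is reduced to inequalities for the non-increasing right-continuous functions \<open>h\<close>, which
  are exactly the rearrangements.  If \<open>\<parallel>h(a \<cdot>)\<parallel> \<le> c a\<^sup>-\<^sup>\<alpha> \<parallel>h\<parallel>\<close> with \<open>\<alpha> < 1/U\<close> and \<open>\<alpha> < \<beta> < 1/U\<close>, then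
  \<open>h v \<le> (t/v)\<^sup>\<beta> x(t)\<close> for \<open>v < t\<close>, where \<open>x(t) = \<Sum>\<^sub>n r\<^bsup>n\<beta>\<^esup> h(r\<^bsup>n+1\<^esup> t)\<close>, so the Hardy operator is
  dominated by \<open>x\<close>, and \<open>\<parallel>x\<parallel>\<close> is controlled by \<open>\<parallel>h\<parallel>\<close> once \<open>r\<close> is small compared with the constant of
  the quasi-triangle inequality.

  Conversely, the Hardy operator dominates \<open>S h(t) = sup\<^bsub>s \<le> 1\<^esub> s\<^bsup>1/U\<^esup> h(s t)\<close>, and the Hardy operator
  applied to \<open>S h\<close> dominates \<open>a\<^bsup>1/U\<^esup> (ln (1/a))\<^bsup>1/W\<^esup> h(a t)\<close>.  The logarithm gives a bound strictly better
  than \<open>a\<^bsup>-1/U\<^esup>\<close> for one small \<open>a\<close>, and submultiplicativity of the dilation norms turns it into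
  \<open>p\<^sub>E > U\<close>.  The case of \<open>q\<^sub>E\<close> is dual; there one loses a dilation by the factor \<open>2\<close>, which is bounded on
  \<open>E\<close> because \<open>E\<close> is quasi-normed.
\<close>

section \<open>Non-increasing right-continuous functions on the interval\<close>

text \<open>The equation with the supremum says at once that \<open>h\<close> is non-increasing and right-continuous.\<close>

definition rcdec :: "ennreal \<Rightarrow> (real \<Rightarrow> ennreal) \<Rightarrow> bool" where
  "rcdec L h \<longleftrightarrow> (\<forall>t>0. h t = (SUP u\<in>{t<..}. h u) \<and> (t \<notin> dom L \<longrightarrow> h t = 0))"

text \<open>The test is on \<open>t\<close>, not on \<open>a * t\<close>: for \<open>a > 1\<close>
  an \<open>rcdec\<close> function is already 0 at points \<open>a * t\<close> beyond the interval,
  while for \<open>a < 1\<close> and finite \<open>L\<close> the cut-off keeps the dilate supported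
  in the interval, hence \<open>rcdec\<close>.\<close>

definition dilate :: "ennreal \<Rightarrow> real \<Rightarrow> (real \<Rightarrow> ennreal) \<Rightarrow> real \<Rightarrow> ennreal" where
  "dilate L a h t = (if t \<in> dom L then h (a * t) else 0)"

lemma dom_sets [measurable, simp]: "dom L \<in> sets lebesgue"
proof -
  have "dom L \<in> sets borel"
    unfolding dom_def by measurable
  then show ?thesis by simp
qed

lemma dom_pos: "t \<in> dom L \<Longrightarrow> 0 < t"
  by (simp add: dom_def)

lemma dom_mono: "t \<in> dom L \<Longrightarrow> 0 < s \<Longrightarrow> s \<le> t \<Longrightarrow> s \<in> dom L"
  unfolding dom_def by (auto intro: le_less_trans ennreal_leI)

lemma dom_open_right:
  assumes "t \<in> dom L" shows "\<exists>u>t. u \<in> dom L"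
proof -
  have t: "0 < t" "ennreal t < L" using assms by (auto simp: dom_def)
  obtain y where y: "ennreal t < y" "y < L" using dense[OF t(2)] by auto
  then obtain u where u: "y = ennreal u" "0 \<le> u" by (cases y) auto
  show ?thesis
    using y t u by (intro exI[of _ u]) (auto simp: dom_def ennreal_less_iff)
qed

text \<open>The superlevel sets of a monotone function are intervals, hence Borel.\<close>

lemma measurable_antimono_on_dom:
  fixes f :: "real \<Rightarrow> ennreal"
  assumes "\<And>x y. x \<in> dom L \<Longrightarrow> y \<in> dom L \<Longrightarrow> x \<le> y \<Longrightarrow> f y \<le> f x"
  shows "f \<in> borel_measurable (lebesgue_on (dom L))"
proof (rule borel_measurableI_greater)
  fix y
  have "is_interval {x \<in> dom L. y < f x}"
    unfolding is_interval_1
    by (smt (verit, best) assms dom_mono dom_pos leD le_less_trans mem_Collect_eq not_le_imp_less)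
  then have "{x \<in> dom L. y < f x} \<in> sets borel" by (rule real_interval_borel_measurable)
  then show "{x \<in> space (lebesgue_on (dom L)). y < f x} \<in> sets (lebesgue_on (dom L))"
    by (auto simp: sets_restrict_space_iff)
qed

lemma measurable_mono_on_dom:
  fixes f :: "real \<Rightarrow> ennreal"
  assumes "\<And>x y. x \<in> dom L \<Longrightarrow> y \<in> dom L \<Longrightarrow> x \<le> y \<Longrightarrow> f x \<le> f y"
  shows "f \<in> borel_measurable (lebesgue_on (dom L))"
proof (rule borel_measurableI_greater)
  fix y
  have "is_interval {x \<in> dom L. y < f x}"
    unfolding is_interval_1
    by (smt (verit, best) assms dom_mono dom_pos leD less_le_trans mem_Collect_eq not_le_imp_less)
  then have "{x \<in> dom L. y < f x} \<in> sets borel" by (rule real_interval_borel_measurable)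
  then show "{x \<in> space (lebesgue_on (dom L)). y < f x} \<in> sets (lebesgue_on (dom L))"
    by (auto simp: sets_restrict_space_iff)
qed

lemma rcdec_antimono: "rcdec L h \<Longrightarrow> 0 < t \<Longrightarrow> t \<le> u \<Longrightarrow> h u \<le> h t"
  unfolding rcdec_def by (metis SUP_upper greaterThan_iff order_le_less)

lemma rcdec_approx:
  assumes "rcdec L h" "0 < t" "y < h t" shows "\<exists>u>t. y < h u"
proof -
  have "h t = (SUP u\<in>{t<..}. h u)" using assms by (auto simp: rcdec_def)
  with assms(3) show ?thesis by (auto simp: less_SUP_iff)
qed

text \<open>Approximation with \<open>y \<le> h u\<close> in place of a strict inequality suffices
  because the order of \<open>ennreal\<close> is dense.\<close>

lemma rcdecI:
  assumes "\<And>t u. 0 < t \<Longrightarrow> t \<le> u \<Longrightarrow> h u \<le> h t"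
    and "\<And>t y. 0 < t \<Longrightarrow> y < h t \<Longrightarrow> \<exists>u>t. y \<le> h u"
    and "\<And>t. 0 < t \<Longrightarrow> t \<notin> dom L \<Longrightarrow> h t = 0"
  shows "rcdec L h"
  unfolding rcdec_def
proof (intro allI impI conjI)
  fix t :: real assume t: "0 < t"
  show "h t = (SUP u\<in>{t<..}. h u)"
  proof (rule antisym)
    show "h t \<le> (SUP u\<in>{t<..}. h u)"
    proof (rule dense_le)
      fix y assume "y < h t"
      then obtain u where "u > t" "y \<le> h u" using assms(2) t by blast
      then show "y \<le> (SUP u\<in>{t<..}. h u)" by (intro SUP_upper2[of u]) auto
    qed
    show "(SUP u\<in>{t<..}. h u) \<le> h t" using assms(1) t by (intro SUP_least) auto
  qed
qed (use assms(3) in auto)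

lemma rcdec_measurable: "rcdec L h \<Longrightarrow> h \<in> borel_measurable (lebesgue_on (dom L))"
  by (rule measurable_antimono_on_dom) (auto intro: rcdec_antimono dest: dom_pos)

lemma rcdec_outside: "rcdec L h \<Longrightarrow> 0 < t \<Longrightarrow> t \<notin> dom L \<Longrightarrow> h t = 0"
  unfolding rcdec_def by blast

lemma rcdec_cmult:
  assumes "rcdec L h" shows "rcdec L (\<lambda>t. ennreal c * h t)"
  unfolding rcdec_def
proof (intro allI impI conjI)
  fix t :: real assume t: "0 < t"
  then have "h t = (SUP u\<in>{t<..}. h u)" using assms by (simp add: rcdec_def)
  then show "ennreal c * h t = (SUP u\<in>{t<..}. ennreal c * h u)"
    by (metis SUP_mult_left_ennreal)
  show "ennreal c * h t = 0" if "t \<notin> dom L" using assms t that by (simp add: rcdec_outside)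
qed

text \<open>For non-increasing functions right-continuity amounts to lower semicontinuity, which
  survives arbitrary suprema. This makes the dilation maximal functions used below
  admissible.\<close>

lemma rcdec_SUP:
  assumes "\<And>i. i \<in> I \<Longrightarrow> rcdec L (h i)" shows "rcdec L (\<lambda>t. SUP i\<in>I. h i t)"
proof (rule rcdecI)
  fix t y assume "0 < t" "y < (SUP i\<in>I. h i t)"
  then obtain i where i: "i \<in> I" "y < h i t" by (auto simp: less_SUP_iff)
  then obtain u where "u > t" "y < h i u" using rcdec_approx[OF assms] \<open>0 < t\<close> by blast
  then show "\<exists>u>t. y \<le> (SUP i\<in>I. h i u)"
    using i by (intro exI[of _ u]) (auto intro: SUP_upper2[of i])
next
  fix t u :: real assume "0 < t" "t \<le> u"
  then show "(SUP i\<in>I. h i u) \<le> (SUP i\<in>I. h i t)"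
    by (intro SUP_mono) (auto intro: rcdec_antimono assms)
next
  fix t :: real assume "0 < t" "t \<notin> dom L"
  then have "(SUP i\<in>I. h i t) \<le> 0"
    by (intro SUP_least) (simp add: rcdec_outside[OF assms])
  then show "(SUP i\<in>I. h i t) = 0" by simp
qed

lemma rcdec_dilate:
  assumes "rcdec L h" "0 < a" shows "rcdec L (dilate L a h)"
proof (rule rcdecI)
  fix t u :: real assume "0 < t" "t \<le> u"
  then show "dilate L a h u \<le> dilate L a h t"
    using assms by (auto simp: dilate_def intro!: rcdec_antimono dest: dom_mono)
next
  fix t y assume t: "0 < t" and y: "y < dilate L a h t"
  then have td: "t \<in> dom L" and yh: "y < h (a * t)" by (auto simp: dilate_def split: if_splits)
  obtain w where w: "w > a * t" "y < h w" using rcdec_approx[OF assms(1) _ yh] assms(2) t by auto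
  obtain v where v: "v > t" "v \<in> dom L" using dom_open_right[OF td] by auto
  \<comment> \<open>The minimum with \<open>v\<close> keeps \<open>u\<close> inside the interval,
    the one with \<open>w / a\<close> keeps \<open>a * u\<close> at most \<open>w\<close>.\<close>
  define u where "u = min v (w / a)"
  have "t < w / a" using w(1) assms(2) by (simp add: field_simps)
  then have u1: "t < u" using v by (simp add: u_def)
  have "u \<le> w / a" by (simp add: u_def)
  then have u3: "a * u \<le> w" using assms(2) by (simp add: field_simps)
  have u2: "u \<in> dom L" using u1 t by (intro dom_mono[OF v(2)]) (auto simp: u_def)
  note u = u1 u2 u3
  have "h w \<le> h (a * u)" using u t assms by (intro rcdec_antimono[OF assms(1)]) auto
  then show "\<exists>u>t. y \<le> dilate L a h u"
    using u w(2) by (intro exI[of _ u]) (auto simp: dilate_def)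
qed (auto simp: dilate_def)

text \<open>An infinite value at \<open>t\<close> would spread by monotonicity to all of (0,t), a
  set of positive measure.\<close>

lemma rcdec_finite_off_null:
  assumes "rcdec L h" "AE x in lebesgue_on (dom L). h x < \<infinity>" "t \<in> dom L"
  shows "h t < \<infinity>"
proof (rule ccontr)
  assume "\<not> h t < \<infinity>"
  then have ht: "h t = \<infinity>" by (simp add: less_top[symmetric])
  have "AE x in lebesgue. x \<in> dom L \<longrightarrow> h x < \<infinity>"
    using assms(2) by (simp add: AE_restrict_space_iff)
  then have "AE x in lebesgue. x \<notin> {0<..<t}"
  proof (rule AE_mp, intro AE_I2 impI notI)
    fix x assume x: "x \<in> dom L \<longrightarrow> h x < \<infinity>" "x \<in> {0<..<t}"
    then have "x \<in> dom L" "h t \<le> h x"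
      using rcdec_antimono[OF assms(1)] dom_mono[OF assms(3)] by auto
    then show False using x ht by (auto simp: top_unique)
  qed
  then have "emeasure lebesgue {0<..<t} = 0" by (subst (asm) AE_iff_measurable[where N="{0<..<t}"]) auto
  then show False using dom_pos[OF assms(3)] by simp
qed

section \<open>Weighted integrals and Hardy operators\<close>

lemma epowr_ennreal: "0 \<le> x \<Longrightarrow> epowr (ennreal x) r = ennreal (x powr r)"
  by (simp add: epowr_def)

lemma epowr_top: "epowr top r = top"
  by (simp add: epowr_def)

lemma epowr_1: "epowr x 1 = x"
  by (cases x) (auto simp: epowr_ennreal epowr_top)

lemma epowr_eq_0_iff: "epowr x r = 0 \<longleftrightarrow> x = 0"
  by (cases x) (auto simp: epowr_ennreal epowr_top)

lemma epowr_mult: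
  assumes "0 < r" shows "epowr (x * y) r = epowr x r * epowr y r"
proof (cases x)
  case top
  then show ?thesis by (cases "y = 0") (auto simp: epowr_top ennreal_top_mult epowr_ennreal[of 0, simplified] epowr_eq_0_iff)
next
  case (real a)
  note a = this
  show ?thesis
  proof (cases y)
    case top
    then show ?thesis using a by (cases "x = 0") (auto simp: epowr_top ennreal_mult_top epowr_ennreal[of 0, simplified] epowr_eq_0_iff)
  next
    case (real b)
    then show ?thesis using a by (simp add: epowr_ennreal ennreal_mult[symmetric] powr_mult)
  qed
qed

lemma epowr_mono:
  assumes "0 \<le> r" "x \<le> y" shows "epowr x r \<le> epowr y r"
proof (cases y)
  case top
  then show ?thesis by (simp add: epowr_top)
next
  case (real b)
  with assms(2) obtain a where "x = ennreal a" "0 \<le> a" by (cases x) (auto simp: top_unique)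
  then show ?thesis using real assms by (auto simp: epowr_ennreal intro!: ennreal_leI powr_mono2)
qed

lemma epowr_epowr: "epowr (epowr x r) s = epowr x (r * s)"
  by (cases x) (auto simp: epowr_ennreal epowr_top powr_powr)

lemma Lq_norm_mono:
  assumes "0 < W" "A \<subseteq> B" "\<And>v. v \<in> A \<Longrightarrow> f v \<le> g v"
  shows "Lq_norm W A f \<le> Lq_norm W B g"
  unfolding Lq_norm_def using assms
  by (intro epowr_mono nn_integral_mono) (auto simp: indicator_def intro!: epowr_mono)

lemma Lq_norm_cong:
  assumes "\<And>v. v \<in> A \<Longrightarrow> f v = g v" shows "Lq_norm W A f = Lq_norm W A g"
  unfolding Lq_norm_def using assms
  by (intro arg_cong[where f = "\<lambda>x. epowr x _"] nn_integral_cong) (auto simp: indicator_def)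

text \<open>A power times a constant is the model profile with which \<open>h\<close> is compared,
  both from below and from above; the constant factors out of the integral.\<close>

lemma Lq_norm_power_weight:
  assumes W: "0 < W" and A: "A \<in> sets borel" "A \<subseteq> {0<..}"
  shows "Lq_norm W A (\<lambda>v. ennreal (v powr (\<gamma> - 1 / W)) * (ennreal (v powr (- \<beta>)) * x)) =
     epowr (\<integral>\<^sup>+v\<in>A. ennreal (v powr ((\<gamma> - \<beta>) * W - 1)) \<partial>lebesgue) (1 / W) * x"
proof -
  have e: "epowr (ennreal (v powr (\<gamma> - 1 / W)) * (ennreal (v powr (- \<beta>)) * x)) W =
      ennreal (v powr ((\<gamma> - \<beta>) * W - 1)) * epowr x W" if v: "0 < v" for v :: real
  proof -
    have "ennreal (v powr (\<gamma> - 1 / W)) * (ennreal (v powr (- \<beta>)) * x) = ennreal (v powr (\<gamma> - 1 / W - \<beta>)) * x"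
      by (simp add: mult.assoc[symmetric] ennreal_mult[symmetric] powr_add[symmetric])
    moreover have "(\<gamma> - 1 / W - \<beta>) * W = (\<gamma> - \<beta>) * W - 1" using W by (simp add: field_simps)
    ultimately show ?thesis using W by (simp add: epowr_mult epowr_ennreal powr_powr)
  qed
  have "(\<integral>\<^sup>+v\<in>A. epowr (ennreal (v powr (\<gamma> - 1 / W)) * (ennreal (v powr (- \<beta>)) * x)) W \<partial>lebesgue) =
      (\<integral>\<^sup>+v. (ennreal (v powr ((\<gamma> - \<beta>) * W - 1)) * indicator A v) * epowr x W \<partial>lebesgue)"
    using A e by (intro nn_integral_cong) (auto simp: indicator_def)
  also have "\<dots> = (\<integral>\<^sup>+v. ennreal (v powr ((\<gamma> - \<beta>) * W - 1)) * indicator A v \<partial>lebesgue) * epowr x W"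
  proof (rule nn_integral_multc)
    note [measurable] = A(1)
    show "(\<lambda>v. ennreal (v powr ((\<gamma> - \<beta>) * W - 1)) * indicator A v) \<in> borel_measurable lebesgue"
      by (rule measurable_completion) measurable
  qed
  finally show ?thesis
    unfolding Lq_norm_def using W by (simp add: epowr_mult epowr_epowr epowr_1)
qed

lemma nn_integral_powr_0:
  fixes e t :: real
  assumes "0 < e" "0 < t"
  shows "(\<integral>\<^sup>+v\<in>{0<..<t}. ennreal (v powr (e - 1)) \<partial>lebesgue) \<le> ennreal (t powr e / e)"
proof -
  have "(\<integral>\<^sup>+v\<in>{0<..<t}. ennreal (v powr (e - 1)) \<partial>lebesgue) \<le> (\<integral>\<^sup>+v\<in>{0..t}. ennreal (v powr (e - 1)) \<partial>lebesgue)"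
    by (intro nn_integral_mono) (auto simp: indicator_def)
  also have "\<dots> = ennreal (t powr e / e)"
    using has_integral_powr_from_0[of "e - 1" t] assms
    by (simp add: nn_integral_completion nn_integral_has_integral_lebesgue')
  finally show ?thesis .
qed

lemma nn_integral_powr_inf:
  fixes e t :: real
  assumes "0 < e" "0 < t" "A \<subseteq> {t<..}"
  shows "(\<integral>\<^sup>+v\<in>A. ennreal (v powr (- e - 1)) \<partial>lebesgue) \<le> ennreal (t powr (- e) / e)"
proof -
  have "(\<integral>\<^sup>+v\<in>A. ennreal (v powr (- e - 1)) \<partial>lebesgue) \<le> (\<integral>\<^sup>+v\<in>{t..}. ennreal (v powr (- e - 1)) \<partial>lebesgue)"
    using assms(3) by (intro nn_integral_mono) (auto simp: indicator_def)
  also have "\<dots> = ennreal (t powr (- e) / e)"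
    using has_integral_powr_to_inf[of "- e - 1" t] assms
    by (simp add: nn_integral_completion nn_integral_has_integral_lebesgue')
  finally show ?thesis .
qed

text \<open>The critical exponent -1: this integral is the source of the logarithmic gain.\<close>

lemma nn_integral_inverse_Ioo:
  fixes p q :: real
  assumes "0 < p" "p < q"
  shows "(\<integral>\<^sup>+v\<in>{p<..<q}. ennreal (v powr (- 1)) \<partial>lebesgue) = ennreal (ln (q / p))"
proof -
  have "((\<lambda>v. v powr (- 1)) has_integral (ln q - ln p)) {p..q}"
    using assms
    by (intro fundamental_theorem_of_calculus)
      (auto simp: powr_minus_divide has_real_derivative_iff_has_vector_derivative[symmetric]
        intro!: derivative_eq_intros)
  then have "((\<lambda>v. v powr (- 1)) has_integral (ln q - ln p)) {p<..<q}"
    using has_integral_open_interval[of "\<lambda>v. v powr (- 1)" "ln q - ln p" p q] by (simp add: box_real)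
  then show ?thesis
    using assms by (simp add: nn_integral_completion nn_integral_has_integral_lebesgue' ln_div)
qed

text \<open>One operator for both kinds of averages: \<open>A t\<close> is (0,t) or (t,L), and
  \<gamma> stands for 1/U or 1/V, so that an infinite V becomes \<gamma> = 0.\<close>

definition hardy :: "(real \<Rightarrow> real set) \<Rightarrow> real \<Rightarrow> real \<Rightarrow> (real \<Rightarrow> ennreal) \<Rightarrow> real \<Rightarrow> ennreal" where
  "hardy A \<gamma> W h t =
     ennreal (t powr (- \<gamma>)) * Lq_norm W (A t) (\<lambda>v. ennreal (v powr (\<gamma> - 1 / W)) * h v)"

text \<open>The profile v^(-\<gamma>) cancels the weight and leaves the integral of 1/v over (p,q).
  With q = 2p this yields a fixed constant, with a large ratio q/p the logarithmic factor.\<close>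

lemma hardy_ge:
  assumes W: "0 < W" and p: "0 < p" "p < q" and A: "{p<..<q} \<subseteq> A t" and t: "0 < t"
    and h: "\<And>v. p < v \<Longrightarrow> v < q \<Longrightarrow> ennreal ((p / v) powr \<gamma>) * x \<le> h v"
  shows "ennreal ((p / t) powr \<gamma> * ln (q / p) powr (1 / W)) * x \<le> hardy A \<gamma> W h t"
proof -
  have ln0: "0 \<le> ln (q / p)" using p by simp
  have "ennreal ((p / t) powr \<gamma> * ln (q / p) powr (1 / W)) * x =
      ennreal (t powr (- \<gamma>)) * (ennreal (ln (q / p) powr (1 / W)) * (ennreal (p powr \<gamma>) * x))"
    using p t by (simp add: mult.assoc[symmetric] ennreal_mult[symmetric] powr_divide powr_minus_divide mult_ac)
  also have "ennreal (ln (q / p) powr (1 / W)) * (ennreal (p powr \<gamma>) * x) =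
      Lq_norm W {p<..<q} (\<lambda>v. ennreal (v powr (\<gamma> - 1 / W)) * (ennreal (v powr (- \<gamma>)) * (ennreal (p powr \<gamma>) * x)))"
    using Lq_norm_power_weight[OF W, of "{p<..<q}" \<gamma> \<gamma>] nn_integral_inverse_Ioo[OF p] p ln0
    by (subst Lq_norm_power_weight[OF W]) (auto simp: epowr_ennreal)
  also have "\<dots> \<le> Lq_norm W (A t) (\<lambda>v. ennreal (v powr (\<gamma> - 1 / W)) * h v)"
  proof (rule Lq_norm_mono[OF W A])
    fix v assume v: "v \<in> {p<..<q}"
    have "ennreal (v powr (- \<gamma>)) * (ennreal (p powr \<gamma>) * x) = ennreal ((p / v) powr \<gamma>) * x"
      using p v by (simp add: mult.assoc[symmetric] ennreal_mult[symmetric] powr_divide powr_minus_divide)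
    also have "\<dots> \<le> h v" using h v by auto
    finally show "ennreal (v powr (\<gamma> - 1 / W)) * (ennreal (v powr (- \<gamma>)) * (ennreal (p powr \<gamma>) * x))
        \<le> ennreal (v powr (\<gamma> - 1 / W)) * h v" by (rule mult_left_mono) simp
  qed
  finally show ?thesis by (simp add: hardy_def mult_left_mono)
qed

text \<open>Comparison with the profile (t/v)^\<beta>: the powers of \<open>t\<close> coming from
  the weight, the profile and the integral cancel, so the constant does not depend on
  \<open>t\<close>.\<close>

lemma hardy_le:
  assumes W: "0 < W" and t: "0 < t" and A: "A t \<in> sets borel" "A t \<subseteq> {0<..}"
    and h: "\<And>v. v \<in> A t \<Longrightarrow> h v \<le> ennreal ((t / v) powr \<beta>) * x"
    and I: "(\<integral>\<^sup>+v\<in>A t. ennreal (v powr ((\<gamma> - \<beta>) * W - 1)) \<partial>lebesgue) \<le> ennreal (t powr ((\<gamma> - \<beta>) * W) * k)"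
    and k: "0 \<le> k"
  shows "hardy A \<gamma> W h t \<le> ennreal (k powr (1 / W)) * x"
proof -
  let ?y = "ennreal (t powr \<beta>) * x"
  have "Lq_norm W (A t) (\<lambda>v. ennreal (v powr (\<gamma> - 1 / W)) * h v) \<le>
      Lq_norm W (A t) (\<lambda>v. ennreal (v powr (\<gamma> - 1 / W)) * (ennreal (v powr (- \<beta>)) * ?y))"
  proof (rule Lq_norm_mono[OF W order_refl])
    fix v assume v: "v \<in> A t"
    then have "0 < v" using A(2) by auto
    then have "ennreal ((t / v) powr \<beta>) * x = ennreal (v powr (- \<beta>)) * ?y"
      using t by (simp add: mult.assoc[symmetric] ennreal_mult[symmetric] powr_divide powr_minus_divide)
    then have "h v \<le> ennreal (v powr (- \<beta>)) * ?y" using h[OF v] by simp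
    then show "ennreal (v powr (\<gamma> - 1 / W)) * h v \<le>
        ennreal (v powr (\<gamma> - 1 / W)) * (ennreal (v powr (- \<beta>)) * ?y)" by (rule mult_left_mono) simp
  qed
  also have "\<dots> = epowr (\<integral>\<^sup>+v\<in>A t. ennreal (v powr ((\<gamma> - \<beta>) * W - 1)) \<partial>lebesgue) (1 / W) * ?y"
    by (rule Lq_norm_power_weight[OF W A])
  also have "\<dots> \<le> epowr (ennreal (t powr ((\<gamma> - \<beta>) * W) * k)) (1 / W) * ?y"
    using W by (intro mult_right_mono epowr_mono I) auto
  also have "\<dots> = ennreal (t powr \<gamma>) * (ennreal (k powr (1 / W)) * x)"
  proof -
    have eq: "t powr (\<gamma> - \<beta>) * k powr (1 / W) * t powr \<beta> = t powr \<gamma> * k powr (1 / W)"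
      by (simp add: powr_diff t)
    show ?thesis using W k
      by (simp add: epowr_ennreal powr_mult powr_powr mult.assoc[symmetric] ennreal_mult[symmetric])
        (simp only: eq)
  qed
  finally have "hardy A \<gamma> W h t \<le> ennreal (t powr (- \<gamma>)) * (ennreal (t powr \<gamma>) * (ennreal (k powr (1 / W)) * x))"
    unfolding hardy_def by (rule mult_left_mono) simp
  also have "\<dots> = ennreal (k powr (1 / W)) * x"
    using t by (simp add: mult.assoc[symmetric] ennreal_mult[symmetric] powr_minus_divide)
  finally show ?thesis .
qed

abbreviation upto :: "real \<Rightarrow> real set" where "upto \<equiv> \<lambda>t. {0<..<t}"
abbreviation beyond :: "ennreal \<Rightarrow> real \<Rightarrow> real set" where "beyond L \<equiv> \<lambda>t. {v. t < v \<and> ennreal v < L}"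

text \<open>Here \<beta> < \<gamma> makes the integral converge at 0; in the next lemma \<gamma> <
  \<beta> makes it converge at infinity.\<close>

lemma hardy_upto_le:
  assumes "0 < W" "0 < t" "\<beta> < \<gamma>"
    and "\<And>v. 0 < v \<Longrightarrow> v < t \<Longrightarrow> h v \<le> ennreal ((t / v) powr \<beta>) * x"
  shows "hardy upto \<gamma> W h t \<le> ennreal ((1 / ((\<gamma> - \<beta>) * W)) powr (1 / W)) * x"
  using assms nn_integral_powr_0[of "(\<gamma> - \<beta>) * W" t]
  by (intro hardy_le[where \<beta> = \<beta>]) auto

lemma hardy_beyond_le:
  assumes "0 < W" "0 < t" "\<gamma> < \<beta>"
    and "\<And>v. t < v \<Longrightarrow> ennreal v < L \<Longrightarrow> h v \<le> ennreal ((t / v) powr \<beta>) * x"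
  shows "hardy (beyond L) \<gamma> W h t \<le> ennreal ((1 / ((\<beta> - \<gamma>) * W)) powr (1 / W)) * x"
proof (rule hardy_le[where \<beta> = \<beta>])
  have "(\<gamma> - \<beta>) * W = - ((\<beta> - \<gamma>) * W)" by (simp add: algebra_simps)
  then show "(\<integral>\<^sup>+v\<in>beyond L t. ennreal (v powr ((\<gamma> - \<beta>) * W - 1)) \<partial>lebesgue)
      \<le> ennreal (t powr ((\<gamma> - \<beta>) * W) * (1 / ((\<beta> - \<gamma>) * W)))"
    using nn_integral_powr_inf[of "(\<beta> - \<gamma>) * W" t "beyond L t"] assms by (simp, auto)
qed (use assms in auto)

section \<open>The quasi-norm\<close>

locale function_qn =
  fixes L :: ennreal and \<rho> :: "(real \<Rightarrow> ennreal) \<Rightarrow> ennreal"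
  assumes fqn: "function_quasi_norm L \<rho>"
begin

abbreviation M where "M \<equiv> lebesgue_on (dom L)"
abbreviation N where "N \<equiv> B_norm L \<rho>"

lemma Mplus_iff: "f \<in> Mplus L \<longleftrightarrow> f \<in> borel_measurable M \<and> (AE x in M. f x < \<infinity>)"
  by (simp add: Mplus_def)

lemma N_eq_rho: "f \<in> Mplus L \<Longrightarrow> N f = \<rho> f"
  by (simp add: B_norm_def Mplus_iff)

lemma N_infinite: "\<not> (AE x in M. f x < \<infinity>) \<Longrightarrow> N f = \<infinity>"
  by (auto simp: B_norm_def)

lemma N_finite_imp_Mplus: "f \<in> borel_measurable M \<Longrightarrow> N f < \<infinity> \<Longrightarrow> f \<in> Mplus L"
  by (auto simp: B_norm_def Mplus_iff split: if_splits)

lemma N_eq_0_iff: "f \<in> Mplus L \<Longrightarrow> N f = 0 \<longleftrightarrow> (AE x in M. f x = 0)"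
  using fqn by (simp add: function_quasi_norm_def N_eq_rho)

lemma N_mono:
  assumes "f \<in> borel_measurable M" "g \<in> borel_measurable M" "AE x in M. g x \<le> f x"
  shows "N g \<le> N f"
proof (cases "AE x in M. f x < \<infinity>")
  case True
  then have "AE x in M. g x < \<infinity>" using assms(3) by eventually_elim (auto intro: le_less_trans)
  then have "f \<in> Mplus L" "g \<in> Mplus L" using True assms by (auto simp: Mplus_iff)
  then show ?thesis using fqn assms(3) by (auto simp: function_quasi_norm_def N_eq_rho)
qed (simp add: N_infinite)

lemma N_mono_dom:
  assumes "f \<in> borel_measurable M" "g \<in> borel_measurable M" "\<And>x. x \<in> dom L \<Longrightarrow> g x \<le> f x"
  shows "N g \<le> N f"
  using assms by (intro N_mono) (auto intro!: AE_I2)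

lemma N_cong:
  assumes "g \<in> borel_measurable M" "\<And>x. x \<in> dom L \<Longrightarrow> f x = g x"
  shows "N f = N g"
proof -
  have "f \<in> borel_measurable M \<longleftrightarrow> g \<in> borel_measurable M"
    using assms(2) by (intro measurable_cong) auto
  then show ?thesis
    using assms by (intro antisym N_mono_dom) auto
qed

lemma N_cmult:
  assumes "f \<in> borel_measurable M" "0 < c"
  shows "N (\<lambda>x. ennreal c * f x) = ennreal c * N f"
proof (cases "AE x in M. f x < \<infinity>")
  case True
  then have f: "f \<in> Mplus L" using assms by (auto simp: Mplus_iff)
  have "(\<lambda>x. ennreal c * f x) \<in> Mplus L"
  proof -
    have "AE x in M. ennreal c * f x < \<infinity>"
      using True by eventually_elim (simp add: ennreal_mult_less_top)
    then show ?thesis using assms by (simp add: Mplus_iff)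
  qed
  then have "N (\<lambda>x. ennreal c * f x) = \<rho> (\<lambda>x. ennreal c * f x)" by (rule N_eq_rho)
  also have "\<dots> = ennreal c * \<rho> f"
    using f fqn less_imp_le[OF assms(2)] unfolding function_quasi_norm_def by blast
  finally show ?thesis using f by (simp add: N_eq_rho)
next
  case False
  have "ennreal c * x < \<infinity> \<longleftrightarrow> x < \<infinity>" for x
    using assms(2) by (auto simp: ennreal_mult_less_top)
  then have "\<not> (AE x in M. ennreal c * f x < \<infinity>)" using False by simp
  then show ?thesis using False assms(2) by (simp add: N_infinite ennreal_mult_top)
qed

lemma N_add_ex:
  "\<exists>C\<ge>1. \<forall>f\<in>borel_measurable M. \<forall>g\<in>borel_measurable M.
     N (\<lambda>x. f x + g x) \<le> ennreal C * (N f + N g)"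
proof -
  obtain C where C: "1 \<le> C"
    "\<And>f g. f \<in> Mplus L \<Longrightarrow> g \<in> Mplus L \<Longrightarrow> \<rho> (\<lambda>x. f x + g x) \<le> ennreal C * (\<rho> f + \<rho> g)"
  proof -
    have "\<exists>C::real. 1 \<le> C \<and>
        (\<forall>f\<in>Mplus L. \<forall>g\<in>Mplus L. \<rho> (\<lambda>x. f x + g x) \<le> ennreal C * (\<rho> f + \<rho> g))"
      using fqn by (simp only: function_quasi_norm_def)
    then show ?thesis using that by blast
  qed
  show ?thesis
  proof (intro exI[of _ C] conjI ballI C(1))
    fix f g :: "real \<Rightarrow> ennreal"
    assume m: "f \<in> borel_measurable M" "g \<in> borel_measurable M"
    show "N (\<lambda>x. f x + g x) \<le> ennreal C * (N f + N g)"
    proof (cases "(AE x in M. f x < \<infinity>) \<and> (AE x in M. g x < \<infinity>)")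
      case True
      then have "AE x in M. f x + g x < \<infinity>" by auto
      then have "(\<lambda>x. f x + g x) \<in> Mplus L" using m by (auto simp: Mplus_iff)
      moreover have "f \<in> Mplus L" "g \<in> Mplus L" using True m by (auto simp: Mplus_iff)
      ultimately show ?thesis using C(2) by (simp add: N_eq_rho)
    next
      case False
      then have "N f + N g = top" by (auto simp: N_infinite)
      moreover have "ennreal C \<noteq> 0" using C(1) by (simp add: ennreal_eq_0_iff)
      ultimately show ?thesis by (simp only: ennreal_mult_top) simp
    qed
  qed
qed

definition Cq :: real where
  "Cq = (SOME C. 1 \<le> C \<and> (\<forall>f\<in>borel_measurable M. \<forall>g\<in>borel_measurable M.
     N (\<lambda>x. f x + g x) \<le> ennreal C * (N f + N g)))"

lemma Cq: "1 \<le> Cq"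
  and N_add: "f \<in> borel_measurable M \<Longrightarrow> g \<in> borel_measurable M \<Longrightarrow>
     N (\<lambda>x. f x + g x) \<le> ennreal Cq * (N f + N g)"
  using someI_ex[OF N_add_ex] unfolding Cq_def by auto

lemma N_SUP_finite:
  assumes m: "\<And>n. F n \<in> borel_measurable M" and inc: "\<And>x. x \<in> dom L \<Longrightarrow> incseq (\<lambda>n. F n x)"
    and fin: "AE x in M. (SUP n. F n x) < \<infinity>"
  shows "N (\<lambda>x. SUP n. F n x) \<le> (SUP n. N (F n))"
proof (cases "(SUP n. N (F n)) < \<infinity>")
  case True
  have f: "(\<lambda>x. SUP n. F n x) \<in> Mplus L" using m fin by (simp add: Mplus_iff)
  have Fn: "F n \<in> Mplus L" for n
  proof -
    have "AE x in M. F n x < \<infinity>"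
      using fin by eventually_elim (meson SUP_upper UNIV_I le_less_trans)
    then show ?thesis using m by (simp add: Mplus_iff)
  qed
  have lim: "AE x in M. incseq (\<lambda>n. F n x) \<and> (\<lambda>n. F n x) \<longlonglongrightarrow> (SUP n. F n x)"
    using inc by (intro AE_I2) (auto intro: LIMSEQ_SUP)
  have "(SUP n. \<rho> (F n)) < \<infinity>" using True by (simp add: N_eq_rho[OF Fn])
  then have "(\<lambda>n. \<rho> (F n)) \<longlonglongrightarrow> \<rho> (\<lambda>x. SUP n. F n x)"
    using fqn Fn f lim unfolding function_quasi_norm_def by blast
  then have "\<rho> (\<lambda>x. SUP n. F n x) \<le> (SUP n. \<rho> (F n))"
    by (rule LIMSEQ_le_const2) (auto intro!: exI[of _ 0] SUP_upper)
  then show ?thesis by (simp add: N_eq_rho[OF Fn] N_eq_rho[OF f])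
next
  case False
  then have "(SUP n. N (F n)) = \<infinity>" by (metis infinity_ennreal_def less_top)
  then show ?thesis by (metis infinity_ennreal_def top_greatest)
qed

text \<open>
  The monotone convergence axiom only speaks about limits that are finite almost everywhere; the
  other case follows by applying it to the truncations.
\<close>

lemma N_SUP:
  assumes m: "\<And>n. F n \<in> borel_measurable M" and inc: "\<And>x. x \<in> dom L \<Longrightarrow> incseq (\<lambda>n. F n x)"
  shows "N (\<lambda>x. SUP n. F n x) \<le> (SUP n. N (F n))"
proof (cases "AE x in M. (SUP n. F n x) < \<infinity>")
  case True
  then show ?thesis using assms by (intro N_SUP_finite)
next
  case False
  let ?S = "SUP n. N (F n)"
  let ?f = "\<lambda>x. SUP n. F n x"
  define w :: "real \<Rightarrow> ennreal" where "w = indicator {x \<in> space M. ?f x = \<infinity>}"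
  have wm: "w \<in> borel_measurable M" unfolding w_def using m by measurable
  have w: "w \<in> Mplus L" using wm by (auto simp: Mplus_iff w_def indicator_def)
  have "\<not> (AE x in M. w x = 0)"
  proof
    assume "AE x in M. w x = 0"
    with AE_space have "AE x in M. ?f x < \<infinity>"
      by eventually_elim (simp add: w_def indicator_def less_top[symmetric] split: if_splits)
    then show False using False by simp
  qed
  then have w0: "N w \<noteq> 0" using N_eq_0_iff[OF w] by simp
  \<comment> \<open>\<open>w\<close> marks the non-null set where the limit is infinite. Truncation
    at \<open>c\<close> makes the limit finite, and equal to \<open>c\<close> on that set. As
    \<open>c\<close> is arbitrary and \<open>N w\<close> is not 0, the right-hand side must be
    infinite.\<close>
  have key: "ennreal c * N w \<le> ?S" if c: "0 < c" for c
  proof -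
    have minmax: "(SUP n. min (ennreal c) (F n x)) = min (ennreal c) (?f x)" for x
      using inf_SUP[of "ennreal c" "\<lambda>n. F n x" UNIV] by (simp add: inf_min)
    have "ennreal c * N w = N (\<lambda>x. ennreal c * w x)" using wm c by (simp add: N_cmult)
    also have "\<dots> \<le> N (\<lambda>x. SUP n. min (ennreal c) (F n x))"
    proof (rule N_mono_dom)
      show "ennreal c * w x \<le> (SUP n. min (ennreal c) (F n x))" for x
      proof (cases "x \<in> space M \<and> ?f x = \<infinity>")
        case True
        then have fx: "?f x = \<infinity>" by (rule conjunct2)
        have w1: "w x = 1" using True unfolding w_def by (intro indicator_simps(1) CollectI)
        show ?thesis unfolding minmax w1 fx by simp
      next
        case False
        then have "w x = 0" unfolding w_def by (intro indicator_simps(2)) blast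
        then show ?thesis by simp
      qed
    qed (use m wm in auto)
    also have "\<dots> \<le> (SUP n. N (\<lambda>x. min (ennreal c) (F n x)))"
    proof (rule N_SUP_finite)
      show "AE x in M. (SUP n. min (ennreal c) (F n x)) < \<infinity>"
        unfolding minmax by (simp add: min_less_iff_disj)
      show "incseq (\<lambda>n. min (ennreal c) (F n x))" if "x \<in> dom L" for x
        using inc[OF that] unfolding incseq_def by (blast intro: min.mono order_refl)
    qed (use m in auto)
    also have "\<dots> \<le> ?S" using m by (intro SUP_mono') (auto intro!: N_mono_dom)
    finally show ?thesis .
  qed
  have "?S = \<infinity>"
  proof (rule ccontr)
    assume "?S \<noteq> \<infinity>"
    then obtain s where s: "?S = ennreal s" "0 \<le> s" by (cases ?S) auto
    have "N w \<le> ennreal s" using key[of 1] s by simp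
    then obtain r where r: "N w = ennreal r" "0 < r"
      using w0 by (cases "N w") (auto simp: top_unique less_le)
    have "ennreal ((s + 1) / r) * ennreal r \<le> ennreal s" using key[of "(s+1)/r"] r s by simp
    then show False using r s by (simp add: ennreal_mult[symmetric])
  qed
  then show ?thesis by (metis infinity_ennreal_def top_greatest)
qed

lemma N_zero: "N (\<lambda>_. 0) = 0"
  by (subst N_eq_0_iff) (auto simp: Mplus_iff)

text \<open>Since the first summand is split off at each step, the term with index \<open>k\<close>
  passes through k + 1 quasi-triangle inequalities.\<close>

lemma N_sum_finite:
  fixes g :: "nat \<Rightarrow> real \<Rightarrow> ennreal"
  assumes "\<And>n. g n \<in> borel_measurable M"
  shows "N (\<lambda>x. \<Sum>k<n. g k x) \<le> (\<Sum>k<n. ennreal (Cq ^ (k + 1)) * N (g k))"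
  using assms
proof (induction n arbitrary: g)
  case (Suc n)
  have "N (\<lambda>x. \<Sum>k<Suc n. g k x) = N (\<lambda>x. g 0 x + (\<Sum>k<n. g (Suc k) x))"
    by (simp only: sum.lessThan_Suc_shift)
  also have "\<dots> \<le> ennreal Cq * (N (g 0) + N (\<lambda>x. \<Sum>k<n. g (Suc k) x))"
    using Suc.prems by (intro N_add) auto
  also have "\<dots> \<le> ennreal Cq * (N (g 0) + (\<Sum>k<n. ennreal (Cq ^ (k + 1)) * N (g (Suc k))))"
    using Suc by (intro mult_left_mono add_left_mono) auto
  also have "\<dots> = (\<Sum>k<Suc n. ennreal (Cq ^ (k + 1)) * N (g k))"
    using Cq by (simp only: sum.lessThan_Suc_shift)
      (simp add: sum_distrib_left ring_distribs ennreal_mult mult.assoc)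
  finally show ?case .
qed (simp add: N_zero)

text \<open>The decay beats the constant of the quasi-triangle inequality, so no Aoki--Rolewicz renorming is needed.\<close>

lemma N_suminf_geometric:
  fixes g :: "nat \<Rightarrow> real \<Rightarrow> ennreal"
  assumes m: "\<And>n. g n \<in> borel_measurable M"
    and b: "\<And>n. N (g n) \<le> ennreal (K * \<theta> ^ n) * s" and "0 \<le> K" "0 \<le> \<theta>" "Cq * \<theta> \<le> 1 / 2"
  shows "N (\<lambda>x. \<Sum>n. g n x) \<le> ennreal (2 * Cq * K) * s"
proof -
  have "N (\<lambda>x. \<Sum>n. g n x) = N (\<lambda>x. SUP n. \<Sum>k<n. g k x)"
    by (simp add: suminf_eq_SUP)
  also have "\<dots> \<le> (SUP n. N (\<lambda>x. \<Sum>k<n. g k x))"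
    using m by (intro N_SUP) (auto simp: incseq_def intro!: sum_mono2)
  also have "\<dots> \<le> ennreal (2 * Cq * K) * s"
  proof (rule SUP_least)
    fix n
    have "N (\<lambda>x. \<Sum>k<n. g k x) \<le> (\<Sum>k<n. ennreal (Cq ^ (k + 1)) * N (g k))"
      using m by (rule N_sum_finite)
    also have "\<dots> \<le> (\<Sum>k<n. ennreal (Cq ^ (k + 1)) * (ennreal (K * \<theta> ^ k) * s))"
      by (intro sum_mono mult_left_mono b) auto
    also have "\<dots> = (\<Sum>k<n. ennreal (Cq * K * (Cq * \<theta>) ^ k) * s)"
    proof (intro sum.cong refl)
      fix k
      have "Cq ^ (k + 1) * (K * \<theta> ^ k) = Cq * K * (Cq * \<theta>) ^ k"
        by (simp add: power_mult_distrib)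
      moreover have "ennreal (Cq ^ (k + 1) * (K * \<theta> ^ k)) = ennreal (Cq ^ (k + 1)) * ennreal (K * \<theta> ^ k)"
        using Cq assms(3,4) by (intro ennreal_mult) auto
      ultimately show "ennreal (Cq ^ (k + 1)) * (ennreal (K * \<theta> ^ k) * s) = ennreal (Cq * K * (Cq * \<theta>) ^ k) * s"
        by (simp only: mult.assoc[symmetric])
    qed
    also have "\<dots> \<le> (\<Sum>k<n. ennreal (Cq * K * (1 / 2) ^ k) * s)"
      using Cq assms(3-5) by (intro sum_mono mult_right_mono ennreal_leI mult_left_mono power_mono) auto
    also have "\<dots> = ennreal (Cq * K * (\<Sum>k<n. (1 / 2) ^ k)) * s"
      using Cq assms(3) by (simp add: sum_distrib_right[symmetric] sum_distrib_left)
    also have "\<dots> \<le> ennreal (2 * Cq * K) * s"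
    proof (intro mult_right_mono ennreal_leI)
      have "(\<Sum>k<n. (1 / 2 :: real) ^ k) \<le> 2" by (simp add: sum_gp_strict)
      then have "Cq * K * (\<Sum>k<n. (1 / 2) ^ k) \<le> Cq * K * 2"
        using Cq assms(3) by (intro mult_left_mono) auto
      then show "Cq * K * (\<Sum>k<n. (1 / 2) ^ k) \<le> 2 * Cq * K" by simp
    qed simp
    finally show "N (\<lambda>x. \<Sum>k<n. g k x) \<le> ennreal (2 * Cq * K) * s" .
  qed
  finally show ?thesis .
qed

end

section \<open>Rearrangements and dilations\<close>

text \<open>Slightly larger levels r + e are tested because \<open>x\<close> may be 0, which is not
  an admissible level in the infimum.\<close>

lemma rearr_le:
  assumes "\<And>l. 0 < l \<Longrightarrow> x \<le> ennreal l \<Longrightarrow> emeasure lebesgue {y \<in> dom L. cmod (f y) > l} \<le> ennreal t"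
  shows "rearr L f t \<le> x"
proof (cases "x = \<infinity>")
  case False
  then obtain r where r: "x = ennreal r" "0 \<le> r" by (cases x) auto
  show ?thesis
  proof (rule ennreal_le_epsilon)
    fix e :: real assume e: "0 < e"
    have "emeasure lebesgue {y \<in> dom L. cmod (f y) > r + e} \<le> ennreal t"
      using assms[of "r + e"] r e by (auto intro: ennreal_leI)
    then have "rearr L f t \<le> ennreal (r + e)"
      unfolding rearr_def using r e by (intro Inf_lower CollectI exI[of _ "r + e"]) auto
    then show "rearr L f t \<le> x + ennreal e" using r e by simp
  qed
qed simp

lemma rearr_ge:
  assumes "\<And>l. 0 < l \<Longrightarrow> emeasure lebesgue {y \<in> dom L. cmod (f y) > l} \<le> ennreal t \<Longrightarrow> x \<le> ennreal l"
  shows "x \<le> rearr L f t"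
  unfolding rearr_def using assms by (auto intro!: Inf_greatest)

lemma rearr_antimono: "t \<le> u \<Longrightarrow> rearr L f u \<le> rearr L f t"
  unfolding rearr_def by (intro Inf_superset_mono) (blast intro: order_trans ennreal_leI)

lemma rearr_measurable: "rearr L f \<in> borel_measurable (lebesgue_on (dom L))"
  by (rule measurable_antimono_on_dom) (rule rearr_antimono)

lemma distribution_sets:
  assumes "f \<in> Mfun L" shows "{y \<in> dom L. cmod (f y) > l} \<in> sets lebesgue"
proof -
  have f: "f \<in> borel_measurable (lebesgue_on (dom L))" using assms by (simp add: Mfun_def)
  have "{y \<in> space (lebesgue_on (dom L)). cmod (f y) > l} \<in> sets (lebesgue_on (dom L))"
    using f by measurable
  then show ?thesis by (simp add: sets_restrict_space_iff)
qed

lemma emeasure_dom_le: "0 < t \<Longrightarrow> t \<notin> dom L \<Longrightarrow> emeasure lebesgue (dom L) \<le> ennreal t"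
proof -
  assume "0 < t" "t \<notin> dom L"
  then have "x < t" if "x \<in> dom L" for x using dom_mono[OF that, of t] by (cases "t \<le> x") auto
  then have "dom L \<subseteq> {0<..<t}" using dom_pos by auto
  then have "emeasure lebesgue (dom L) \<le> emeasure lebesgue {0<..<t}" by (intro emeasure_mono) auto
  then show ?thesis using \<open>0 < t\<close> by simp
qed

text \<open>If \<open>y\<close> is below the rearrangement at \<open>t\<close>, some level
  \<open>l\<close> above \<open>y\<close> has a superlevel set of measure strictly greater than
  \<open>t\<close>, hence greater than some u > t; then \<open>y\<close> is still a lower bound at
  \<open>u\<close>. For \<open>t\<close> outside the interval every positive level is admissible,
  because the whole interval has measure at most \<open>t\<close>.\<close>

lemma rcdec_rearr:
  assumes f: "f \<in> Mfun L" shows "rcdec L (rearr L f)"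
proof (rule rcdecI)
  fix t y assume t: "0 < t" and y: "y < rearr L f t"
  then obtain y' where y': "y < y'" "y' < rearr L f t" using dense by blast
  then obtain l where l: "y' = ennreal l" "0 \<le> l" by (cases y') auto
  have l0: "0 < l" using y' l by (auto intro: le_neq_trans)
  have "\<not> emeasure lebesgue {x \<in> dom L. cmod (f x) > l} \<le> ennreal t"
  proof
    assume "emeasure lebesgue {x \<in> dom L. cmod (f x) > l} \<le> ennreal t"
    then have "rearr L f t \<le> ennreal l" unfolding rearr_def using l0 by (intro Inf_lower) auto
    then show False using y' l by auto
  qed
  then have "ennreal t < emeasure lebesgue {x \<in> dom L. cmod (f x) > l}" by simp
  then obtain z where z: "ennreal t < z" "z < emeasure lebesgue {x \<in> dom L. cmod (f x) > l}"
    using dense by blast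
  then obtain u where u: "z = ennreal u" "0 \<le> u" by (cases z) auto
  have "y \<le> rearr L f u"
  proof (rule rearr_ge)
    fix l' assume l': "0 < l'" "emeasure lebesgue {x \<in> dom L. cmod (f x) > l'} \<le> ennreal u"
    have "\<not> l' \<le> l"
    proof
      assume "l' \<le> l"
      then have "emeasure lebesgue {x \<in> dom L. cmod (f x) > l} \<le> emeasure lebesgue {x \<in> dom L. cmod (f x) > l'}"
        by (intro emeasure_mono distribution_sets[OF f]) auto
      then show False using l' z u by auto
    qed
    then show "y \<le> ennreal l'" using y' l by (meson ennreal_leI leI less_imp_le order_trans)
  qed
  then show "\<exists>u>t. y \<le> rearr L f u" using z u t by (intro exI[of _ u]) (auto simp: ennreal_less_iff)
next
  fix t :: real assume t: "0 < t" "t \<notin> dom L"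
  have "rearr L f t \<le> 0"
  proof (rule rearr_le)
    fix l :: real
    have "emeasure lebesgue {y \<in> dom L. l < cmod (f y)} \<le> emeasure lebesgue (dom L)"
      by (intro emeasure_mono) auto
    also have "\<dots> \<le> ennreal t" using t by (intro emeasure_dom_le) auto
    finally show "emeasure lebesgue {y \<in> dom L. l < cmod (f y)} \<le> ennreal t" .
  qed
  then show "rearr L f t = 0" by simp
qed (rule rearr_antimono)

text \<open>Turns a finite-valued \<open>rcdec\<close> function into a complex function having it as
  rearrangement. \<open>enn2real\<close> sends infinity to 0, so finiteness has to be known
  first.\<close>

definition realize :: "(real \<Rightarrow> ennreal) \<Rightarrow> real \<Rightarrow> complex" where
  "realize h x = complex_of_real (enn2real (h x))"

lemma realize_Mfun: "h \<in> borel_measurable (lebesgue_on (dom L)) \<Longrightarrow> realize h \<in> Mfun L"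
  unfolding Mfun_def realize_def by measurable

lemma cmod_realize_gt:
  assumes "h x < \<infinity>" "0 < l" shows "cmod (realize h x) > l \<longleftrightarrow> h x > ennreal l"
  using assms by (cases "h x") (auto simp: realize_def ennreal_less_iff)

lemma rearr_cong:
  assumes "\<And>x. x \<in> dom L \<Longrightarrow> f x = g x" shows "rearr L f = rearr L g"
proof -
  have "{x \<in> dom L. cmod (f x) > l} = {x \<in> dom L. cmod (g x) > l}" for l using assms by auto
  then show ?thesis by (simp add: rearr_def fun_eq_iff)
qed

text \<open>The superlevel sets of \<open>h\<close> are initial intervals: inside (0,t) if
  \<open>h t\<close> is at most the level, and otherwise, by right-continuity, containing (0,u) for
  some u > t.\<close>

lemma rearr_realize:
  assumes h: "rcdec L h" and fin: "\<And>x. x \<in> dom L \<Longrightarrow> h x < \<infinity>" and t: "0 < t"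
  shows "rearr L (realize h) t = h t"
proof (rule antisym)
  have D: "{x \<in> dom L. cmod (realize h x) > l} = {x \<in> dom L. h x > ennreal l}" if "0 < l" for l
    using cmod_realize_gt[OF fin that] by auto
  show "rearr L (realize h) t \<le> h t"
  proof (rule rearr_le)
    fix l assume l: "0 < l" "h t \<le> ennreal l"
    have "{x \<in> dom L. h x > ennreal l} \<subseteq> {0<..<t}"
    proof
      fix x assume x: "x \<in> {x \<in> dom L. h x > ennreal l}"
      have "\<not> t \<le> x" using rcdec_antimono[OF h t, of x] l x by (auto dest: order_trans)
      then show "x \<in> {0<..<t}" using x dom_pos by auto
    qed
    then have "emeasure lebesgue {x \<in> dom L. h x > ennreal l} \<le> emeasure lebesgue {0<..<t}"
      by (intro emeasure_mono) auto
    then show "emeasure lebesgue {x \<in> dom L. l < cmod (realize h x)} \<le> ennreal t"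
      using t l by (simp add: D)
  qed
  show "h t \<le> rearr L (realize h) t"
  proof (rule rearr_ge)
    fix l assume l: "0 < l" "emeasure lebesgue {x \<in> dom L. l < cmod (realize h x)} \<le> ennreal t"
    show "h t \<le> ennreal l"
    proof (rule ccontr)
      assume "\<not> h t \<le> ennreal l"
      then obtain u where u: "u > t" "ennreal l < h u" using rcdec_approx[OF h t] by (auto simp: not_le)
      then have ud: "u \<in> dom L" using rcdec_outside[OF h, of u] t by (metis less_trans not_less_zero)
      have sub: "{0<..<u} \<subseteq> {x \<in> dom L. l < cmod (realize h x)}"
        unfolding D[OF l(1)] using dom_mono[OF ud] u rcdec_antimono[OF h]
        by (auto intro: less_le_trans)
      have "ennreal u = emeasure lebesgue {0<..<u}" using u t by simp
      also have "\<dots> \<le> emeasure lebesgue {x \<in> dom L. l < cmod (realize h x)}"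
        by (intro emeasure_mono sub distribution_sets realize_Mfun rcdec_measurable h)
      also note l(2)
      finally show False using u t by (simp add: ennreal_le_iff)
    qed
  qed
qed

text \<open>The superlevel set of the dilate lies in the superlevel set of \<open>f\<close> scaled
  by 1/a. For \<open>a < 1\<close> and finite \<open>L\<close> part of the scaled set may leave the
  interval, hence an inequality.\<close>

lemma rearr_dil_le:
  assumes f: "f \<in> Mfun L" and a: "0 < a"
  shows "rearr L (dil L a f) t \<le> rearr L f (a * t)"
proof (rule rearr_ge)
  fix l :: real assume l: "0 < l" "emeasure lebesgue {y \<in> dom L. l < cmod (f y)} \<le> ennreal (a * t)"
  let ?A = "{y \<in> dom L. l < cmod (f y)}"
  let ?T = "(\<lambda>x. (1 / a) *\<^sub>R x + 0) ` ?A"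
  have eT: "emeasure lebesgue ?T = ennreal (1 / a) * emeasure lebesgue ?A"
    using emeasure_lebesgue_affine[of "1 / a" 0 ?A] a by simp
  have sub: "{y \<in> dom L. l < cmod (dil L a f y)} \<subseteq> ?T"
  proof
    fix y assume "y \<in> {y \<in> dom L. l < cmod (dil L a f y)}"
    then have "a * y \<in> ?A" using l by (auto simp: dil_def split: if_splits)
    moreover have "y = (1 / a) *\<^sub>R (a * y) + 0" using a by simp
    ultimately show "y \<in> ?T" by blast
  qed
  have "?T = (\<lambda>y. a *\<^sub>R y) -` ?A \<inter> space lebesgue"
    using a by (force simp: image_iff)
  then have Tm: "?T \<in> sets lebesgue"
    using measurable_sets[OF lebesgue_measurable_scaling distribution_sets[OF f]] by simp
  have "emeasure lebesgue {y \<in> dom L. l < cmod (dil L a f y)} \<le> ennreal (1 / a) * emeasure lebesgue ?A"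
    using emeasure_mono[OF sub Tm] eT by simp
  also have "\<dots> \<le> ennreal (1 / a) * ennreal (a * t)" by (intro mult_left_mono l) auto
  also have "\<dots> = ennreal t" using a by (simp add: ennreal_mult'[symmetric])
  finally show "rearr L (dil L a f) t \<le> ennreal l"
    unfolding rearr_def using l by (intro Inf_lower) auto
qed

section \<open>Dilation norms on non-increasing functions\<close>

context function_qn
begin

text \<open>On non-increasing functions the rearrangement disappears from the dilation norm, and
  infinite values cause no trouble. \<open>dil_norm_le_iff\<close> shows that this is the usual
  operator bound.\<close>

definition dilation_bound :: "real \<Rightarrow> real \<Rightarrow> bool" where
  "dilation_bound a K \<longleftrightarrow> (\<forall>h. rcdec L h \<longrightarrow> N (\<lambda>t. h (a * t)) \<le> ennreal K * N h)"

lemma rcdec_scaled_measurable: "rcdec L h \<Longrightarrow> 0 < a \<Longrightarrow> (\<lambda>t. h (a * t)) \<in> borel_measurable M"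
  by (rule measurable_antimono_on_dom) (auto intro!: rcdec_antimono dest: dom_pos)

lemma N_dilate: "rcdec L h \<Longrightarrow> 0 < a \<Longrightarrow> N (dilate L a h) = N (\<lambda>t. h (a * t))"
  by (rule N_cong) (auto simp: dilate_def rcdec_scaled_measurable)

lemma rcdec_finite: "rcdec L h \<Longrightarrow> N h < \<infinity> \<Longrightarrow> t \<in> dom L \<Longrightarrow> h t < \<infinity>"
  using N_finite_imp_Mplus[OF rcdec_measurable] rcdec_finite_off_null unfolding Mplus_iff by blast

lemma dilation_bound_mono:
  assumes "dilation_bound a K" "0 < a" "a \<le> b" "K \<le> K'" shows "dilation_bound b K'"
  unfolding dilation_bound_def
proof (intro allI impI)
  fix h assume h: "rcdec L h"
  have "N (\<lambda>t. h (b * t)) \<le> N (\<lambda>t. h (a * t))"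
    using assms h by (intro N_mono_dom rcdec_scaled_measurable rcdec_antimono[OF h])
      (auto dest: dom_pos intro!: mult_right_mono)
  also have "\<dots> \<le> ennreal K * N h" using assms h by (simp add: dilation_bound_def)
  also have "\<dots> \<le> ennreal K' * N h" using assms by (intro mult_right_mono ennreal_leI) auto
  finally show "N (\<lambda>t. h (b * t)) \<le> ennreal K' * N h" .
qed

text \<open>With \<open>a\<close> and \<open>b\<close> on the same side of 1 the cut-offs in the
  composition are consistent: if b > 1 pushes \<open>b * t\<close> out of the interval, then a \<ge>
  1 keeps \<open>a * b * t\<close> outside, and both sides vanish.\<close>

lemma dilation_bound_mult:
  assumes "dilation_bound a K" "dilation_bound b K'" "0 < a" "0 < b" "a \<le> 1 \<and> b \<le> 1 \<or> 1 \<le> a \<and> 1 \<le> b"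
    "0 \<le> K" "0 \<le> K'"
  shows "dilation_bound (a * b) (K * K')"
  unfolding dilation_bound_def
proof (intro allI impI)
  fix h assume h: "rcdec L h"
  have eq: "h (a * b * t) = dilate L a h (b * t)" if t: "t \<in> dom L" for t
  proof (cases "b * t \<in> dom L")
    case False
    have t0: "0 < t" using t by (rule dom_pos)
    have "\<not> b \<le> 1"
    proof
      assume "b \<le> 1"
      then have "b * t \<le> t" using t0 mult_right_mono[of b 1 t] by simp
      then show False using False dom_mono[OF t, of "b * t"] assms(4) t0 by simp
    qed
    then have "1 \<le> a" using assms(5) by auto
    have "a * b * t \<notin> dom L"
    proof
      assume d: "a * b * t \<in> dom L"
      have "1 * (b * t) \<le> a * (b * t)" using \<open>1 \<le> a\<close> assms(4) t0 by (intro mult_right_mono) auto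
      then show False using False dom_mono[OF d, of "b * t"] assms(4) t0 by (simp add: mult.assoc)
    qed
    then show ?thesis using False rcdec_outside[OF h, of "a * b * t"] assms(3,4) t0 by (simp add: dilate_def)
  qed (simp add: dilate_def mult.assoc)
  have "N (\<lambda>t. h (a * b * t)) = N (\<lambda>t. dilate L a h (b * t))"
    using eq assms h by (intro N_cong rcdec_scaled_measurable rcdec_dilate) auto
  also have "\<dots> \<le> ennreal K' * N (dilate L a h)"
    using assms rcdec_dilate[OF h] by (simp add: dilation_bound_def)
  also have "\<dots> \<le> ennreal K' * (ennreal K * N h)"
    using assms h by (intro mult_left_mono) (auto simp: N_dilate dilation_bound_def)
  also have "\<dots> = ennreal (K * K') * N h" using assms by (simp add: ennreal_mult mult_ac)
  finally show "N (\<lambda>t. h (a * b * t)) \<le> ennreal (K * K') * N h" .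
qed

lemma dilation_bound_1: "dilation_bound 1 1"
  by (simp add: dilation_bound_def)

lemma dilation_bound_power:
  assumes "dilation_bound a K" "0 < a" "0 \<le> K"
  shows "dilation_bound (a ^ n) (K ^ n)"
proof (induction n)
  case (Suc n)
  then show ?case
    using dilation_bound_mult[OF assms(1) Suc.IH] assms
    by (cases "a \<le> 1") (auto simp: power_le_one)
qed (simp add: dilation_bound_1)

lemma E_norm_realize:
  assumes "rcdec L h" "\<And>x. x \<in> dom L \<Longrightarrow> h x < \<infinity>"
  shows "E_norm L \<rho> (realize h) = N h"
  unfolding E_norm_def using assms
  by (intro N_cong) (auto intro: rcdec_measurable rearr_realize dest: dom_pos)

lemma dilation_bound_of_dil_norm:
  assumes d: "dil_norm L \<rho> a \<le> ennreal K" and a: "0 < a" and K: "0 < K"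
  shows "dilation_bound a K"
  unfolding dilation_bound_def
proof (intro allI impI)
  fix h assume h: "rcdec L h"
  show "N (\<lambda>t. h (a * t)) \<le> ennreal K * N h"
  proof (cases "N h")
    case top
    then show ?thesis using K by (simp add: ennreal_mult_top)
  next
    case (real s)
    have fin: "h x < \<infinity>" if "x \<in> dom L" for x using rcdec_finite[OF h _ that] real by simp
    show ?thesis
    proof (rule ennreal_le_epsilon)
      fix e :: real assume e: "0 < e"
      \<comment> \<open>Normalizing by s + e/K rather than by s also covers s = 0, at the price of
        exactly \<open>e\<close> after multiplication by \<open>K\<close>.\<close>
      define c where "c = 1 / (s + e / K)"
      have pos: "0 < s + e / K" using e K real by (simp add: add_nonneg_pos)
      have c: "0 < c" using pos by (simp add: c_def)
      define g where "g = (\<lambda>t. ennreal c * h t)"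
      have g: "rcdec L g" unfolding g_def using h by (rule rcdec_cmult)
      have gfin: "g x < \<infinity>" if "x \<in> dom L" for x
        using fin[OF that] by (simp add: g_def ennreal_mult_less_top)
      have Ng: "N g = ennreal (c * s)" unfolding g_def
        using N_cmult[OF rcdec_measurable[OF h] c] real c by (simp add: ennreal_mult)
      have "c * s \<le> 1" using pos e K by (simp add: c_def)
      then have E1: "E_norm L \<rho> (realize g) \<le> 1" using Ng E_norm_realize[OF g gfin] by simp
      then have "realize g \<in> E_space L \<rho>"
        unfolding E_space_def using realize_Mfun[OF rcdec_measurable[OF g]] by (auto intro: le_less_trans)
      then have "E_norm L \<rho> (dil L a (realize g)) \<le> dil_norm L \<rho> a"
        unfolding dil_norm_def using E1 by (intro SUP_upper) auto
      also note d
      also have "E_norm L \<rho> (dil L a (realize g)) = E_norm L \<rho> (realize (dilate L a g))"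
        unfolding E_norm_def
      proof (rule arg_cong[where f = N], rule rearr_cong)
        fix x assume x: "x \<in> dom L"
        then show "dil L a (realize g) x = realize (dilate L a g) x"
          using rcdec_outside[OF g, of "a * x"] a dom_pos[OF x]
          by (auto simp: dil_def realize_def dilate_def)
      qed
      also have "\<dots> = N (dilate L a g)"
      proof (rule E_norm_realize)
        fix x assume x: "x \<in> dom L"
        then show "dilate L a g x < \<infinity>"
          using rcdec_outside[OF g, of "a * x"] gfin[of "a * x"] a dom_pos[OF x]
          by (cases "a * x \<in> dom L") (auto simp: dilate_def)
      qed (rule rcdec_dilate[OF g a])
      also have "\<dots> = ennreal c * N (\<lambda>t. h (a * t))"
        using N_dilate[OF g a] N_cmult[OF rcdec_scaled_measurable[OF h a] c] by (simp add: g_def)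
      finally have "ennreal (s + e / K) * (ennreal c * N (\<lambda>t. h (a * t))) \<le> ennreal (s + e / K) * ennreal K"
        by (intro mult_left_mono) auto
      moreover have "ennreal (s + e / K) * (ennreal c * N (\<lambda>t. h (a * t))) = N (\<lambda>t. h (a * t))"
        using pos by (simp add: mult.assoc[symmetric] ennreal_mult[symmetric] c_def)
      moreover have "ennreal (s + e / K) * ennreal K = ennreal K * N h + ennreal e"
        using pos e K real by (simp add: ennreal_mult[symmetric] ennreal_plus[symmetric] field_simps del: ennreal_plus)
      ultimately show "N (\<lambda>t. h (a * t)) \<le> ennreal K * N h + ennreal e" by simp
    qed
  qed
qed

lemma dil_norm_of_dilation_bound:
  assumes d: "dilation_bound a K" and a: "0 < a"
  shows "dil_norm L \<rho> a \<le> ennreal K"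
  unfolding dil_norm_def
proof (rule SUP_least)
  fix f assume "f \<in> {f \<in> E_space L \<rho>. E_norm L \<rho> f \<le> 1}"
  then have f: "f \<in> Mfun L" "E_norm L \<rho> f \<le> 1" by (auto simp: E_space_def)
  have "E_norm L \<rho> (dil L a f) \<le> N (\<lambda>t. rearr L f (a * t))"
    unfolding E_norm_def using rearr_dil_le[OF f(1) a]
    by (intro N_mono_dom rearr_measurable rcdec_scaled_measurable rcdec_rearr f a)
  also have "\<dots> \<le> ennreal K * E_norm L \<rho> f"
    using d rcdec_rearr[OF f(1)] by (auto simp: dilation_bound_def E_norm_def)
  also have "\<dots> \<le> ennreal K * 1" by (intro mult_left_mono f) auto
  finally show "E_norm L \<rho> (dil L a f) \<le> ennreal K" by simp
qed

lemma dil_norm_le_iff: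
  "0 < a \<Longrightarrow> 0 < K \<Longrightarrow> dil_norm L \<rho> a \<le> ennreal K \<longleftrightarrow> dilation_bound a K"
  using dilation_bound_of_dil_norm dil_norm_of_dilation_bound by blast

end

text \<open>
  This set and its complement both have density at most \<open>7/8\<close> in every \<open>(0,t)\<close>.  Hence restricting
  \<open>t \<mapsto> h (7 t / 8)\<close> to either of them gives a function with rearrangement at most \<open>h\<close>.
\<close>

definition dyadic_even :: "real set" where
  "dyadic_even = {x. 0 < x \<and> even \<lfloor>log 2 x\<rfloor>}"

lemma dyadic_even_sets: "dyadic_even \<in> sets borel"
  unfolding dyadic_even_def by measurable

text \<open>With 2^n \<le> t < 2^(n+1), one of the intervals [2^(n-1), 2^n) and [2^(n-2), 2^(n-1))
  has the required parity, and both have length at least 2^(n-2) > t/8.\<close>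

lemma dyadic_interval_ex:
  assumes t: "0 < t"
  shows "\<exists>k::int. 2 powr (real_of_int k + 1) \<le> t \<and> t / 8 \<le> 2 powr real_of_int k \<and>
           (\<forall>x\<in>{2 powr real_of_int k..<2 powr (real_of_int k + 1)}. even \<lfloor>log 2 x\<rfloor> = b)"
proof -
  define n where "n = \<lfloor>log 2 t\<rfloor>"
  define k where "k = (if even (n - 1) = b then n - 1 else n - 2)"
  have "real_of_int n \<le> log 2 t" "log 2 t < real_of_int n + 1" by (auto simp: n_def)
  then have n: "2 powr real_of_int n \<le> t" "t < 2 powr (real_of_int n + 1)"
    using t by (auto simp: le_log_iff log_less_iff)
  have ev: "even k = b" by (auto simp: k_def)
  have "k + 1 \<le> n" "n - 2 \<le> k" by (auto simp: k_def)
  then have "2 powr (real_of_int k + 1) \<le> 2 powr real_of_int n"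
      "2 powr (real_of_int n - 2) \<le> 2 powr real_of_int k"
    by (auto intro!: powr_mono simp del: powr_le_cancel_iff)
  moreover have "2 powr (real_of_int n - 2) = 2 powr (real_of_int n + 1) / 8"
    by (simp add: powr_diff powr_add)
  ultimately have "2 powr (real_of_int k + 1) \<le> t" "t / 8 \<le> 2 powr real_of_int k"
    using n by linarith+
  moreover have "even \<lfloor>log 2 x\<rfloor> = b" if "x \<in> {2 powr real_of_int k..<2 powr (real_of_int k + 1)}" for x
  proof -
    have "0 < x" using that by (auto intro: less_le_trans[of 0 "2 powr real_of_int k"])
    then have "\<lfloor>log 2 x\<rfloor> = k" using that by (intro floor_unique) (auto simp: le_log_iff log_less_iff)
    then show ?thesis using ev by simp
  qed
  ultimately show ?thesis by blast
qed

text \<open>The set misses a whole dyadic interval [p, 2p) of the opposite parity with 2p \<le> t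
  and p \<ge> t/8.\<close>

lemma dyadic_even_density:
  assumes t: "0 < t"
  shows "emeasure lebesgue {x. 0 < x \<and> x < t \<and> (x \<in> dyadic_even) = b} \<le> ennreal (7 / 8 * t)"
proof -
  obtain k :: int where k: "2 powr (real_of_int k + 1) \<le> t" "t / 8 \<le> 2 powr real_of_int k"
    "\<And>x. x \<in> {2 powr real_of_int k..<2 powr (real_of_int k + 1)} \<Longrightarrow> even \<lfloor>log 2 x\<rfloor> = (\<not> b)"
    using dyadic_interval_ex[OF t, of "\<not> b"] by blast
  define p :: real where "p = 2 powr real_of_int k"
  have p: "2 * p \<le> t" "t / 8 \<le> p" "0 < p" "2 powr (real_of_int k + 1) = 2 * p"
    using k by (auto simp: p_def powr_add)
  have "{x. 0 < x \<and> x < t \<and> (x \<in> dyadic_even) = b} \<subseteq> {0<..<p} \<union> {2 * p..<t}"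
  proof
    fix x assume x: "x \<in> {x. 0 < x \<and> x < t \<and> (x \<in> dyadic_even) = b}"
    then have "x \<notin> {2 powr real_of_int k..<2 powr (real_of_int k + 1)}"
      using k(3)[of x] by (auto simp: dyadic_even_def)
    then show "x \<in> {0<..<p} \<union> {2 * p..<t}" using x p by (auto simp: p_def)
  qed
  then have "emeasure lebesgue {x. 0 < x \<and> x < t \<and> (x \<in> dyadic_even) = b} \<le> emeasure lebesgue ({0<..<p} \<union> {2 * p..<t})"
    by (intro emeasure_mono) auto
  also have "\<dots> \<le> emeasure lebesgue {0<..<p} + emeasure lebesgue {2 * p..<t}"
    by (intro emeasure_subadditive) auto
  also have "\<dots> = ennreal (t - p)" using p by (simp add: ennreal_plus[symmetric] del: ennreal_plus)
  also have "\<dots> \<le> ennreal (7 / 8 * t)" using p by (intro ennreal_leI) auto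
  finally show ?thesis .
qed

section \<open>Boundedness of the dilation by 1/2 on a quasi-normed E\<close>

locale ri_setting = function_qn +
  assumes Eqn: "E_quasi_norm L \<rho>"
begin

text \<open>The dilate \<open>F\<close> is the sum of its restrictions to \<open>dyadic_even\<close>
  and to the complement. Both have rearrangement at most \<open>h\<close>, so the quasi-triangle
  inequality of E bounds the norm of \<open>F\<close> by \<open>2 * C\<close> times that of
  \<open>h\<close>.\<close>

lemma dilation_bound_7_8: "\<exists>K>0. dilation_bound (7 / 8) K"
proof -
  obtain C :: real where C: "1 \<le> C" "\<And>f g. f \<in> E_space L \<rho> \<Longrightarrow> g \<in> E_space L \<rho> \<Longrightarrow>
        E_norm L \<rho> (\<lambda>x. f x + g x) \<le> ennreal C * (E_norm L \<rho> f + E_norm L \<rho> g)"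
  proof -
    have "\<exists>C::real. 1 \<le> C \<and> (\<forall>f\<in>E_space L \<rho>. \<forall>g\<in>E_space L \<rho>.
        E_norm L \<rho> (\<lambda>x. f x + g x) \<le> ennreal C * (E_norm L \<rho> f + E_norm L \<rho> g))"
      using Eqn by (simp only: E_quasi_norm_def)
    then show ?thesis using that by blast
  qed
  have "dilation_bound (7 / 8) (2 * C)"
    unfolding dilation_bound_def
  proof (intro allI impI)
    fix h assume h: "rcdec L h"
    show "N (\<lambda>t. h (7 / 8 * t)) \<le> ennreal (2 * C) * N h"
    proof (cases "N h < \<infinity>")
      case False
      then have "N h = top" by (simp add: less_top[symmetric])
      then show ?thesis using C(1) by (simp add: ennreal_mult_top)
    next
      case True
      define F where "F = dilate L (7 / 8) h"
      have F: "rcdec L F" unfolding F_def by (rule rcdec_dilate[OF h]) simp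
      have Ffin: "F x < \<infinity>" if x: "x \<in> dom L" for x
        using rcdec_finite[OF h True dom_mono[OF x, of "7 / 8 * x"]] dom_pos[OF x] by (simp add: F_def dilate_def)
      define P where "P b = (\<lambda>x. if (x \<in> dyadic_even) = b then realize F x else 0)" for b
      have P: "P b \<in> Mfun L" for b
      proof -
        have "{x. (x \<in> dyadic_even) = b} \<in> sets borel"
          using dyadic_even_sets by (cases b) (auto simp: Collect_neg_eq[symmetric] Compl_eq[symmetric])
        then have [measurable]: "Measurable.pred M (\<lambda>x. (x \<in> dyadic_even) = b)"
          unfolding pred_def by (auto simp: sets_restrict_space_iff Collect_conj_eq)
        have [measurable]: "realize F \<in> borel_measurable M"
          using realize_Mfun[OF rcdec_measurable[OF F]] by (simp add: Mfun_def)
        show ?thesis unfolding P_def Mfun_def by measurable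
      qed
      have rP: "rearr L (P b) t \<le> h t" if t: "0 < t" for b t
      proof (rule rearr_le)
        fix l assume l: "0 < l" "h t \<le> ennreal l"
        have "{y \<in> dom L. l < cmod (P b y)} \<subseteq> {x. 0 < x \<and> x < 8 / 7 * t \<and> (x \<in> dyadic_even) = b}"
        proof
          fix y assume y: "y \<in> {y \<in> dom L. l < cmod (P b y)}"
          then have yd: "y \<in> dom L" and yb: "(y \<in> dyadic_even) = b" and "l < cmod (realize F y)"
            using l by (auto simp: P_def split: if_splits)
          then have "ennreal l < F y" using cmod_realize_gt[where h = F and x = y, OF Ffin[OF yd] l(1)] by simp
          then have "h t < h (7 / 8 * y)" using l yd by (simp add: F_def dilate_def)
          then have "\<not> t \<le> 7 / 8 * y" using rcdec_antimono[OF h t, of "7 / 8 * y"] by (meson leD)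
          then show "y \<in> {x. 0 < x \<and> x < 8 / 7 * t \<and> (x \<in> dyadic_even) = b}"
            using yb dom_pos[OF yd] by auto
        qed
        then have "emeasure lebesgue {y \<in> dom L. l < cmod (P b y)} \<le>
            emeasure lebesgue {x. 0 < x \<and> x < 8 / 7 * t \<and> (x \<in> dyadic_even) = b}"
        proof (rule emeasure_mono)
          have "{x. 0 < x \<and> x < 8 / 7 * t \<and> (x \<in> dyadic_even) = b} \<in> sets borel"
            using dyadic_even_sets by (cases b) (simp_all, measurable)
          then show "{x. 0 < x \<and> x < 8 / 7 * t \<and> (x \<in> dyadic_even) = b} \<in> sets lebesgue" by simp
        qed
        \<comment> \<open>A point \<open>y\<close> of the superlevel set satisfies 7y/8 < t, and the
          density 7/8 cancels the resulting factor 8/7.\<close>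
        also have "\<dots> \<le> ennreal (7 / 8 * (8 / 7 * t))" using t by (intro dyadic_even_density) auto
        finally show "emeasure lebesgue {y \<in> dom L. l < cmod (P b y)} \<le> ennreal t" by simp
      qed
      have EP: "E_norm L \<rho> (P b) \<le> N h" for b
        unfolding E_norm_def using rP
        by (intro N_mono_dom rearr_measurable rcdec_measurable h) (auto dest: dom_pos)
      have PE: "P b \<in> E_space L \<rho>" for b
        using EP[of b] P[of b] True by (auto simp: E_space_def)
      have "N (\<lambda>t. h (7 / 8 * t)) = N F" unfolding F_def by (rule N_dilate[OF h, symmetric]) simp
      also have "\<dots> = E_norm L \<rho> (realize F)" by (rule E_norm_realize[OF F Ffin, symmetric])
      also have "realize F = (\<lambda>x. P True x + P False x)" by (auto simp: P_def)
      also have "E_norm L \<rho> \<dots> \<le> ennreal C * (E_norm L \<rho> (P True) + E_norm L \<rho> (P False))"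
        by (intro C PE)
      also have "\<dots> \<le> ennreal C * (N h + N h)" by (intro mult_left_mono add_mono EP) auto
      also have "\<dots> = ennreal (2 * C) * N h"
        using C(1) by (simp add: ennreal_mult flip: mult_2) (simp add: mult_ac)
      finally show ?thesis .
    qed
  qed
  then show ?thesis using C(1) by (intro exI[of _ "2 * C"]) auto
qed

lemma dilation_bound_half: "\<exists>K>0. dilation_bound (1 / 2) K"
proof -
  obtain K where K: "K > 0" "dilation_bound (7 / 8) K" using dilation_bound_7_8 by blast
  \<comment> \<open>6 is the least exponent for which the power of 7/8 falls below 1/2.\<close>
  have "dilation_bound ((7 / 8) ^ 6) (K ^ 6)" using K by (intro dilation_bound_power) auto
  then have "dilation_bound (1 / 2) (K ^ 6)"
    by (rule dilation_bound_mono) (simp_all add: power_divide)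
  then show ?thesis using K by (intro exI[of _ "K ^ 6"]) auto
qed

end

section \<open>Boundedness of the Hardy operators\<close>

lemma geometric_index:
  fixes r y :: real
  assumes "0 < r" "r < 1" "0 < y" "y \<le> 1"
  shows "\<exists>n. r ^ (n + 1) \<le> y \<and> y \<le> r ^ n"
proof -
  obtain m where "r ^ m < y" using real_arch_pow_inv assms by blast
  then have ex: "\<exists>n. r ^ (n + 1) \<le> y"
    using assms by (intro exI[of _ m]) (auto intro: order_trans[OF mult_left_le_one_le])
  define n where "n = (LEAST n. r ^ (n + 1) \<le> y)"
  have "r ^ (n + 1) \<le> y" unfolding n_def using ex by (rule LeastI_ex)
  moreover have "y \<le> r ^ n"
  proof (cases n)
    case (Suc k)
    then have "\<not> r ^ (k + 1) \<le> y" unfolding n_def by (intro not_less_Least) simp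
    then show ?thesis using Suc by simp
  qed (use assms in simp)
  ultimately show ?thesis by blast
qed

lemma ennreal_le_divideI:
  assumes "0 < c" "ennreal c * x \<le> y" shows "x \<le> ennreal (1 / c) * y"
proof -
  have "x = ennreal (1 / c) * (ennreal c * x)"
    using assms(1) by (simp add: mult.assoc[symmetric] ennreal_mult[symmetric])
  also have "\<dots> \<le> ennreal (1 / c) * y" by (rule mult_left_mono[OF assms(2)]) simp
  finally show ?thesis .
qed

lemma le_suminf_ennreal: "g n \<le> (\<Sum>n. g n :: ennreal)"
  using sum_le_suminf[of g "{n}"] by simp

context function_qn
begin

lemma powr_measurable_M: "(\<lambda>t::real. ennreal (t powr c)) \<in> borel_measurable M"
  by (intro measurable_restrict_space1 measurable_completion) measurable

text \<open>The \<open>Lq_norm\<close> factor is non-decreasing in \<open>t\<close>, because the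
  domain of integration grows.\<close>

lemma hardy_upto_measurable:
  assumes "0 < W" shows "hardy upto \<gamma> W h \<in> borel_measurable M"
proof -
  have "(\<lambda>t. Lq_norm W (upto t) (\<lambda>v. ennreal (v powr (\<gamma> - 1 / W)) * h v)) \<in> borel_measurable M"
    by (rule measurable_mono_on_dom) (rule Lq_norm_mono[OF assms], auto)
  then show ?thesis unfolding hardy_def using powr_measurable_M by (rule borel_measurable_times_ennreal[rotated])
qed

lemma hardy_beyond_measurable:
  assumes "0 < W" shows "hardy (beyond L) \<gamma> W h \<in> borel_measurable M"
proof -
  have "(\<lambda>t. Lq_norm W (beyond L t) (\<lambda>v. ennreal (v powr (\<gamma> - 1 / W)) * h v)) \<in> borel_measurable M"
    by (rule measurable_antimono_on_dom) (rule Lq_norm_mono[OF assms], auto)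
  then show ?thesis unfolding hardy_def using powr_measurable_M by (rule borel_measurable_times_ennreal[rotated])
qed

lemma N_le_cmult:
  assumes "f \<in> borel_measurable M" "g \<in> borel_measurable M" "0 < c"
    and "\<And>t. t \<in> dom L \<Longrightarrow> f t \<le> ennreal c * g t"
  shows "N f \<le> ennreal c * N g"
proof -
  have "N f \<le> N (\<lambda>t. ennreal c * g t)" using assms by (intro N_mono_dom) auto
  then show ?thesis using N_cmult assms by simp
qed

text \<open>Reduces a series of dilates to the geometric criterion: weight times dilation bound must
  decay with a ratio \<theta> that beats \<open>Cq\<close>.\<close>

lemma N_dilation_series:
  assumes h: "rcdec L h" and a: "\<And>n::nat. 0 < a n" and w: "\<And>n. 0 < w n" and K: "0 \<le> K" "0 \<le> \<theta>" "Cq * \<theta> \<le> 1 / 2"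
    and b: "\<And>n. dilation_bound (a n) (d n)" and d: "\<And>n. w n * d n \<le> K * \<theta> ^ n"
  shows "N (\<lambda>t. \<Sum>n. ennreal (w n) * h (a n * t)) \<le> ennreal (2 * Cq * K) * N h"
proof (rule N_suminf_geometric[OF _ _ K])
  fix n
  note m = rcdec_scaled_measurable[OF h a[of n]]
  show "(\<lambda>t. ennreal (w n) * h (a n * t)) \<in> borel_measurable M" using m by measurable
  have "N (\<lambda>t. ennreal (w n) * h (a n * t)) = ennreal (w n) * N (\<lambda>t. h (a n * t))"
    by (rule N_cmult[OF m w])
  also have "\<dots> \<le> ennreal (w n) * (ennreal (d n) * N h)"
    using b[of n] h by (intro mult_left_mono) (auto simp: dilation_bound_def)
  also have "\<dots> = ennreal (w n * d n) * N h"
    using w[of n] by (simp add: mult.assoc ennreal_mult')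
  also have "\<dots> \<le> ennreal (K * \<theta> ^ n) * N h" by (intro mult_right_mono ennreal_leI d) simp
  finally show "N (\<lambda>t. ennreal (w n) * h (a n * t)) \<le> ennreal (K * \<theta> ^ n) * N h" .
qed

text \<open>The witness solves Cq * r^\<delta> = 1/2, and \<open>Cq \<ge> 1\<close> puts it below
  1.\<close>

lemma ratio_ex:
  assumes "0 < \<delta>" shows "\<exists>r>0. r < 1 \<and> Cq * r powr \<delta> \<le> 1 / 2"
proof (intro exI[of _ "(1 / (2 * Cq)) powr (1 / \<delta>)"] conjI)
  have c: "0 < 1 / (2 * Cq)" "1 / (2 * Cq) < 1" using Cq by auto
  show "0 < (1 / (2 * Cq)) powr (1 / \<delta>)" using c(1) by simp
  show "(1 / (2 * Cq)) powr (1 / \<delta>) < 1"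
    using c assms powr_less_mono2[of "1 / \<delta>" "1 / (2 * Cq)" 1] by simp
  show "Cq * ((1 / (2 * Cq)) powr (1 / \<delta>)) powr \<delta> \<le> 1 / 2"
    using c assms Cq by (simp add: powr_powr)
qed

lemma hardy_upto_bounded:
  assumes W: "0 < W" and \<alpha>: "0 < \<alpha>" "\<alpha> < \<gamma>" and c: "0 < c"
    and b: "\<And>a. 0 < a \<Longrightarrow> a < 1 \<Longrightarrow> dilation_bound a (c * a powr (- \<alpha>))"
  shows "\<exists>K>0. \<forall>h. rcdec L h \<longrightarrow> N (hardy upto \<gamma> W h) \<le> ennreal K * N h"
proof -
  \<comment> \<open>Any exponent strictly between would do: \<beta> < \<gamma> makes the Hardy
    integral converge, and \<alpha> < \<beta> gives the geometric decay of the norms of the terms of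
    \<open>x\<close>.\<close>
  define \<beta> where "\<beta> = (\<alpha> + \<gamma>) / 2"
  have \<beta>: "\<alpha> < \<beta>" "\<beta> < \<gamma>" "0 < \<beta>" using \<alpha> by (auto simp: \<beta>_def)
  obtain r where r: "0 < r" "r < 1" "Cq * r powr (\<beta> - \<alpha>) \<le> 1 / 2" using ratio_ex[of "\<beta> - \<alpha>"] \<beta> by auto
  define k where "k = (1 / ((\<gamma> - \<beta>) * W)) powr (1 / W)"
  have k: "0 < k" using \<beta> W by (simp add: k_def)
  define K where "K = k * (2 * Cq * (c * r powr (- \<alpha>)))"
  have "0 < K" using k Cq c r by (simp add: K_def)
  moreover have "N (hardy upto \<gamma> W h) \<le> ennreal K * N h" if h: "rcdec L h" for h
  proof -
    define x where "x = (\<lambda>t. \<Sum>n. ennreal ((r ^ n) powr \<beta>) * h (r ^ (n + 1) * t))"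
    have xm: "x \<in> borel_measurable M"
      unfolding x_def using r by (intro borel_measurable_suminf_order borel_measurable_times_ennreal rcdec_scaled_measurable[OF h]) auto
    have Nx: "N x \<le> ennreal (2 * Cq * (c * r powr (- \<alpha>))) * N h"
      unfolding x_def
    proof (rule N_dilation_series[OF h, where \<theta> = "r powr (\<beta> - \<alpha>)" and d = "\<lambda>n. c * (r ^ (n + 1)) powr (- \<alpha>)"])
      \<comment> \<open>The power n + 1 keeps the dilation factor strictly below 1 even for n = 0,
        as \<open>b\<close> requires; the shift shows up as r^(-\<alpha>) in
        \<open>K\<close>.\<close>
      show "dilation_bound (r ^ (n + 1)) (c * (r ^ (n + 1)) powr - \<alpha>)" for n
        using r power_Suc_less_one[of r n] by (intro b) auto
      show "(r ^ n) powr \<beta> * (c * (r ^ (n + 1)) powr - \<alpha>) \<le> c * r powr - \<alpha> * (r powr (\<beta> - \<alpha>)) ^ n" for n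
      proof -
        have "(r powr (\<beta> - \<alpha>)) ^ n = (r ^ n) powr (\<beta> - \<alpha>)"
          using r by (simp add: powr_realpow[symmetric] powr_powr mult.commute)
        also have "\<dots> = (r ^ n) powr \<beta> * (r ^ n) powr (- \<alpha>)" by (simp add: powr_add[symmetric])
        finally show ?thesis using r by (simp add: powr_mult)
      qed
    qed (use r c in auto)
    have "N (hardy upto \<gamma> W h) \<le> ennreal k * N x"
    proof (rule N_le_cmult[OF hardy_upto_measurable[OF W] xm k])
      fix t assume "t \<in> dom L"
      then have t: "0 < t" by (rule dom_pos)
      show "hardy upto \<gamma> W h t \<le> ennreal k * x t"
        unfolding k_def
      proof (rule hardy_upto_le[OF W t \<beta>(2)])
        fix v assume v: "0 < v" "v < t"
        then obtain n where n: "r ^ (n + 1) \<le> v / t" "v / t \<le> r ^ n"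
          using geometric_index[OF r(1,2), of "v / t"] t by auto
        have rn: "0 < r ^ n" "0 < r ^ (n + 1)" using r by auto
        have "h v \<le> h (r ^ (n + 1) * t)"
        proof (rule rcdec_antimono[OF h])
          show "0 < r ^ (n + 1) * t" using rn(2) t by (rule mult_pos_pos)
          show "r ^ (n + 1) * t \<le> v" using n(1) t by (simp add: field_simps)
        qed
        also have "\<dots> = ennreal 1 * h (r ^ (n + 1) * t)" by simp
        \<comment> \<open>Since v/t \<le> r^n, the inserted factor is at least 1; it produces the
          term of \<open>x\<close> with index \<open>n\<close>.\<close>
        also have "\<dots> \<le> ennreal (((t / v) * r ^ n) powr \<beta>) * h (r ^ (n + 1) * t)"
          using n(2) v t \<beta> by (intro mult_right_mono ennreal_leI ge_one_powr_ge_zero) (auto simp: field_simps)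
        also have "\<dots> = ennreal ((t / v) powr \<beta>) * (ennreal ((r ^ n) powr \<beta>) * h (r ^ (n + 1) * t))"
          using v t rn by (subst powr_mult) (auto simp: ennreal_mult mult.assoc)
        also have "\<dots> \<le> ennreal ((t / v) powr \<beta>) * x t"
          unfolding x_def by (intro mult_left_mono le_suminf_ennreal[where g = "\<lambda>n. ennreal ((r ^ n) powr \<beta>) * h (r ^ (n + 1) * t)"]) simp
        finally show "h v \<le> ennreal ((t / v) powr \<beta>) * x t" .
      qed
    qed
    also have "\<dots> \<le> ennreal k * (ennreal (2 * Cq * (c * r powr (- \<alpha>))) * N h)"
      by (intro mult_left_mono Nx) simp
    also have "\<dots> = ennreal K * N h" using k Cq c by (simp add: K_def ennreal_mult mult.assoc)
    finally show ?thesis .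
  qed
  ultimately show ?thesis by blast
qed

lemma hardy_beyond_bounded:
  assumes W: "0 < W" and \<alpha>: "0 \<le> \<gamma>" "\<gamma> < \<alpha>" and c: "0 < c"
    and b: "\<And>a. 1 \<le> a \<Longrightarrow> dilation_bound a (c * a powr (- \<alpha>))"
  shows "\<exists>K>0. \<forall>h. rcdec L h \<longrightarrow> N (hardy (beyond L) \<gamma> W h) \<le> ennreal K * N h"
proof -
  define \<beta> where "\<beta> = (\<alpha> + \<gamma>) / 2"
  have \<beta>: "\<beta> < \<alpha>" "\<gamma> < \<beta>" "0 < \<beta>" using \<alpha> by (auto simp: \<beta>_def)
  obtain r where r: "0 < r" "r < 1" "Cq * r powr (\<alpha> - \<beta>) \<le> 1 / 2" using ratio_ex[of "\<alpha> - \<beta>"] \<beta> by auto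
  define k where "k = (1 / ((\<beta> - \<gamma>) * W)) powr (1 / W)"
  have k: "0 < k" using \<beta> W by (simp add: k_def)
  define K where "K = k * (2 * Cq * (c * r powr (- \<beta>)))"
  have "0 < K" using k Cq c r by (simp add: K_def)
  moreover have "N (hardy (beyond L) \<gamma> W h) \<le> ennreal K * N h" if h: "rcdec L h" for h
  proof -
    \<comment> \<open>Here the dilation factors start at 1, which \<open>b\<close> allows, so the
      shift by one sits in the weights and shows up as r^(-\<beta>) in \<open>K\<close>.\<close>
    define x where "x = (\<lambda>t. \<Sum>n. ennreal ((1 / r ^ (n + 1)) powr \<beta>) * h (1 / r ^ n * t))"
    have xm: "x \<in> borel_measurable M"
      unfolding x_def using r by (intro borel_measurable_suminf_order borel_measurable_times_ennreal rcdec_scaled_measurable[OF h]) auto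
    have Nx: "N x \<le> ennreal (2 * Cq * (c * r powr (- \<beta>))) * N h"
      unfolding x_def
    proof (rule N_dilation_series[OF h, where \<theta> = "r powr (\<alpha> - \<beta>)" and d = "\<lambda>n. c * (1 / r ^ n) powr (- \<alpha>)"])
      show "dilation_bound (1 / r ^ n) (c * (1 / r ^ n) powr - \<alpha>)" for n
        using r power_le_one[of r n] by (intro b) auto
      show "(1 / r ^ (n + 1)) powr \<beta> * (c * (1 / r ^ n) powr - \<alpha>) \<le> c * r powr - \<beta> * (r powr (\<alpha> - \<beta>)) ^ n" for n
      proof -
        have "(r powr (\<alpha> - \<beta>)) ^ n = (r ^ n) powr (\<alpha> - \<beta>)"
          using r by (simp add: powr_realpow[symmetric] powr_powr mult.commute)
        also have "\<dots> = (r ^ n) powr \<alpha> * (r ^ n) powr (- \<beta>)" by (simp add: powr_add[symmetric])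
        finally have "(r powr (\<alpha> - \<beta>)) ^ n = (r ^ n) powr \<alpha> * (r ^ n) powr (- \<beta>)" .
        moreover have "(1 / r ^ n) powr - \<alpha> = (r ^ n) powr \<alpha>" using r by (simp add: powr_divide powr_minus_divide)
        moreover have "(1 / r ^ (n + 1)) powr \<beta> = r powr - \<beta> * (r ^ n) powr - \<beta>"
          using r by (simp add: powr_divide powr_minus_divide powr_mult)
        ultimately show ?thesis by simp
      qed
    qed (use r c in auto)
    have "N (hardy (beyond L) \<gamma> W h) \<le> ennreal k * N x"
    proof (rule N_le_cmult[OF hardy_beyond_measurable[OF W] xm k])
      fix t assume "t \<in> dom L"
      then have t: "0 < t" by (rule dom_pos)
      show "hardy (beyond L) \<gamma> W h t \<le> ennreal k * x t"
        unfolding k_def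
      proof (rule hardy_beyond_le[OF W t \<beta>(2)])
        fix v assume v: "t < v" "ennreal v < L"
        then obtain n where n: "r ^ (n + 1) \<le> t / v" "t / v \<le> r ^ n"
          using geometric_index[OF r(1,2), of "t / v"] t by auto
        have rn: "0 < r ^ n" "0 < r ^ (n + 1)" using r by auto
        have "h v \<le> h (1 / r ^ n * t)"
          using n(2) rn t v by (intro rcdec_antimono[OF h]) (auto simp: field_simps)
        also have "\<dots> = ennreal 1 * h (1 / r ^ n * t)" by simp
        also have "\<dots> \<le> ennreal (((t / v) * (1 / r ^ (n + 1))) powr \<beta>) * h (1 / r ^ n * t)"
        proof (intro mult_right_mono ennreal_leI ge_one_powr_ge_zero)
          have "1 \<le> (t / v) / r ^ (n + 1)" using n(1) rn(2) by (subst le_divide_eq_1_pos)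
          then show "1 \<le> (t / v) * (1 / r ^ (n + 1))" by simp
        qed (use \<beta> in auto)
        also have "\<dots> = ennreal ((t / v) powr \<beta>) * (ennreal ((1 / r ^ (n + 1)) powr \<beta>) * h (1 / r ^ n * t))"
          using v t rn by (subst powr_mult) (auto simp: ennreal_mult mult.assoc)
        also have "\<dots> \<le> ennreal ((t / v) powr \<beta>) * x t"
          unfolding x_def by (intro mult_left_mono le_suminf_ennreal[where g = "\<lambda>n. ennreal ((1 / r ^ (n + 1)) powr \<beta>) * h (1 / r ^ n * t)"]) simp
        finally show "h v \<le> ennreal ((t / v) powr \<beta>) * x t" .
      qed
    qed
    also have "\<dots> \<le> ennreal k * (ennreal (2 * Cq * (c * r powr (- \<beta>))) * N h)"
      by (intro mult_left_mono Nx) simp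
    also have "\<dots> = ennreal K * N h" using k Cq c by (simp add: K_def ennreal_mult mult.assoc)
    finally show ?thesis .
  qed
  ultimately show ?thesis by blast
qed

end

section \<open>From bounded Hardy operators to power bounds for dilations\<close>

context function_qn
begin

text \<open>Submultiplicativity gives the bound at the powers of \<open>a\<close>. A bound at one
  factor holds at all larger ones, so the bound at a^(n+1) covers all \<open>s\<close> up to a^n at
  the cost of a^(-\<alpha>).\<close>

lemma dilation_bound_all_small:
  assumes a0: "0 < a" "a < 1" and \<alpha>: "0 < \<alpha>" and b: "dilation_bound a (a powr (- \<alpha>))"
  shows "\<exists>c>0. \<forall>s. 0 < s \<and> s < 1 \<longrightarrow> dilation_bound s (c * s powr (- \<alpha>))"
proof (intro exI[of _ "a powr (- \<alpha>)"] conjI allI impI)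
  fix s :: real assume s: "0 < s \<and> s < 1"
  obtain n where n: "a ^ (n + 1) \<le> s" "s \<le> a ^ n" using geometric_index[OF a0, of s] s by auto
  have "dilation_bound (a ^ (n + 1)) ((a powr (- \<alpha>)) ^ (n + 1))"
    using a0 by (intro dilation_bound_power b) auto
  then show "dilation_bound s (a powr (- \<alpha>) * s powr (- \<alpha>))"
  proof (rule dilation_bound_mono)
    have "(a powr (- \<alpha>)) ^ n = (a ^ n) powr (- \<alpha>)"
      using a0 by (simp add: powr_realpow[symmetric] powr_powr mult.commute)
    also have "\<dots> \<le> s powr (- \<alpha>)" using n(2) s \<alpha> by (intro powr_mono2') auto
    finally show "(a powr - \<alpha>) ^ (n + 1) \<le> a powr - \<alpha> * s powr - \<alpha>"
      by (simp add: mult_left_mono)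
  qed (use a0 n in auto)
qed (use a0 in auto)

text \<open>The same interpolation with a^n \<le> s \<le> a^(n+1): the bound at a^n is carried up to
  \<open>s\<close>, losing a^\<alpha>.\<close>

lemma dilation_bound_all_large:
  assumes a0: "1 < a" and \<alpha>: "0 < \<alpha>" and b: "dilation_bound a (a powr (- \<alpha>))"
  shows "\<exists>c>0. \<forall>s\<ge>1. dilation_bound s (c * s powr (- \<alpha>))"
proof (intro exI[of _ "a powr \<alpha>"] conjI allI impI)
  fix s :: real assume s: "1 \<le> s"
  obtain n where n: "(1 / a) ^ (n + 1) \<le> 1 / s" "1 / s \<le> (1 / a) ^ n"
    using geometric_index[of "1 / a" "1 / s"] s a0 by auto
  have n': "s \<le> a ^ (n + 1)" "a ^ n \<le> s" using n s a0 by (auto simp: power_divide field_simps)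
  have "dilation_bound (a ^ n) ((a powr (- \<alpha>)) ^ n)"
    using a0 by (intro dilation_bound_power b) auto
  then show "dilation_bound s (a powr \<alpha> * s powr (- \<alpha>))"
  proof (rule dilation_bound_mono)
    have "(a powr (- \<alpha>)) ^ n = (a ^ n) powr (- \<alpha>)"
      using a0 by (simp add: powr_realpow[symmetric] powr_powr mult.commute)
    also have "\<dots> = a powr \<alpha> * (a ^ (n + 1)) powr (- \<alpha>)"
      using a0 by (simp add: powr_mult powr_minus_divide)
    also have "\<dots> \<le> a powr \<alpha> * s powr (- \<alpha>)"
      using n'(1) s \<alpha> by (intro mult_left_mono powr_mono2') auto
    finally show "(a powr - \<alpha>) ^ n \<le> a powr \<alpha> * s powr - \<alpha>" .
  qed (use a0 n' in auto)
qed (use a0 in auto)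

text \<open>\<open>x\<close> will be the absolute value of the logarithm of the dilation factor,
  chosen so that the logarithmic gain turns the constant \<open>D\<close> into 1/2.\<close>

lemma log_gain_ex:
  fixes D :: real
  assumes "0 < D" "0 < W"
  shows "\<exists>x>0. D * x powr (- 1 / W) = 1 / 2"
  using assms by (intro exI[of _ "(2 * D) powr W"]) (auto simp: powr_powr powr_minus_divide)

text \<open>
  Applying the Hardy operator to the dilation maximal function of \<open>h\<close>, which it dominates, gains a
  logarithmic factor over the bound \<open>a powr - \<gamma>\<close>; this makes the inequality for the index strict.
\<close>

lemma dilation_bound_of_hardy_upto:
  assumes W: "0 < W" and \<gamma>: "0 < \<gamma>" and K: "0 < K"
    and b: "\<And>h. rcdec L h \<Longrightarrow> N (hardy upto \<gamma> W h) \<le> ennreal K * N h"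
  shows "\<exists>\<alpha>>0. \<alpha> < \<gamma> \<and> (\<exists>c>0. \<forall>a. 0 < a \<and> a < 1 \<longrightarrow> dilation_bound a (c * a powr (- \<alpha>)))"
proof -
  \<comment> \<open>The constant of \<open>hardy_ge\<close> on (st/2, st), where \<open>h\<close> is
    at least h(st).\<close>
  define k where "k = (1 / 2) powr \<gamma> * ln 2 powr (1 / W)"
  have k: "0 < k" by (simp add: k_def)
  define D where "D = K * (1 / k * K)"
  have D: "0 < D" using K k by (simp add: D_def)
  have main: "dilation_bound a (D * (1 / (a powr \<gamma> * ln (1 / a) powr (1 / W))))" if a: "0 < a" "a < 1" for a
    unfolding dilation_bound_def
  proof (intro allI impI)
    fix h assume h: "rcdec L h"
    define S where "S = (\<lambda>t. SUP s\<in>{0<..1}. ennreal (s powr \<gamma>) * dilate L s h t)"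
    have S: "rcdec L S" unfolding S_def by (intro rcdec_SUP rcdec_cmult rcdec_dilate h) auto
    have S_le: "S t \<le> ennreal (1 / k) * hardy upto \<gamma> W h t" if t: "t \<in> dom L" for t
      unfolding S_def
    proof (intro SUP_least ennreal_le_divideI k)
      fix s :: real assume s: "s \<in> {0<..1}"
      have t0: "0 < t" using t by (rule dom_pos)
      have st: "0 < s * t" "s * t \<le> t" using s t0 by (auto simp: mult_le_cancel_right1)
      have "ennreal ((s * t / 2 / t) powr \<gamma> * ln (s * t / (s * t / 2)) powr (1 / W)) * h (s * t) \<le> hardy upto \<gamma> W h t"
      proof (rule hardy_ge[OF W _ _ _ t0])
        fix v assume v: "s * t / 2 < v" "v < s * t"
        have "ennreal ((s * t / 2 / v) powr \<gamma>) * h (s * t) \<le> ennreal 1 * h (s * t)"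
          using v st \<gamma> by (intro mult_right_mono ennreal_leI powr_le1) auto
        also have "\<dots> \<le> h v" using v st by (auto intro: rcdec_antimono[OF h])
        finally show "ennreal ((s * t / 2 / v) powr \<gamma>) * h (s * t) \<le> h v" .
      qed (use st in auto)
      also have "(s * t / 2 / t) powr \<gamma> * ln (s * t / (s * t / 2)) powr (1 / W) = k * s powr \<gamma>"
        using s t0 by (simp add: k_def powr_divide)
      finally show "ennreal k * (ennreal (s powr \<gamma>) * dilate L s h t) \<le> hardy upto \<gamma> W h t"
        using k t by (simp add: dilate_def ennreal_mult mult.assoc)
    qed
    have "N S \<le> ennreal (1 / k) * N (hardy upto \<gamma> W h)"
      using k S_le by (intro N_le_cmult rcdec_measurable S hardy_upto_measurable W) auto
    also have "\<dots> \<le> ennreal (1 / k) * (ennreal K * N h)" by (intro mult_left_mono b h) simp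
    finally have NS: "N S \<le> ennreal (1 / k * K) * N h" using K k by (simp add: ennreal_mult[symmetric] mult.assoc[symmetric])
    define g where "g = a powr \<gamma> * ln (1 / a) powr (1 / W)"
    have g: "0 < g" using a by (simp add: g_def)
    have "N (\<lambda>t. h (a * t)) \<le> ennreal (1 / g) * N (hardy upto \<gamma> W S)"
    proof (rule N_le_cmult[OF rcdec_scaled_measurable[OF h a(1)] hardy_upto_measurable[OF W]])
      fix t assume t: "t \<in> dom L"
      have t0: "0 < t" using t by (rule dom_pos)
      have "ennreal ((a * t / t) powr \<gamma> * ln (t / (a * t)) powr (1 / W)) * h (a * t) \<le> hardy upto \<gamma> W S t"
      proof (rule hardy_ge[OF W _ _ _ t0])
        fix v assume v: "a * t < v" "v < t"
        have at: "0 < a * t" using a t0 by simp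
        have v0: "0 < v" using v at by linarith
        have vd: "v \<in> dom L" using v v0 by (intro dom_mono[OF t]) auto
        \<comment> \<open>The choice s = at/v in the supremum. Thus \<open>S\<close> dominates the
          critical profile on all of (at, t), which has logarithmic length ln(1/a).\<close>
        have "ennreal ((a * t / v) powr \<gamma>) * h (a * t) = ennreal ((a * t / v) powr \<gamma>) * dilate L (a * t / v) h v"
          using vd v0 by (simp add: dilate_def)
        also have "\<dots> \<le> S v" unfolding S_def using v v0 at by (intro SUP_upper) auto
        finally show "ennreal ((a * t / v) powr \<gamma>) * h (a * t) \<le> S v" .
      qed (use a t0 in \<open>auto simp: mult_less_cancel_right1 intro: less_trans[OF mult_pos_pos]\<close>)
      moreover have "(a * t / t) powr \<gamma> * ln (t / (a * t)) powr (1 / W) = g" using t0 by (simp add: g_def)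
      ultimately show "h (a * t) \<le> ennreal (1 / g) * hardy upto \<gamma> W S t"
        using g by (intro ennreal_le_divideI) auto
    qed (use g in simp)
    also have "\<dots> \<le> ennreal (1 / g) * (ennreal K * N S)" by (intro mult_left_mono b S) simp
    also have "\<dots> \<le> ennreal (1 / g) * (ennreal K * (ennreal (1 / k * K) * N h))"
      by (intro mult_left_mono NS) auto
    also have "\<dots> = ennreal (D * (1 / g)) * N h"
    proof -
      have "D * (1 / g) = 1 / g * (K * (1 / k * K))" by (simp add: D_def)
      then show ?thesis using K k g by (simp only: ennreal_mult mult.assoc less_imp_le zero_less_divide_1_iff mult_nonneg_nonneg zero_le_divide_1_iff)
    qed
    finally show "N (\<lambda>t. h (a * t)) \<le> ennreal (D * (1 / (a powr \<gamma> * ln (1 / a) powr (1 / W)))) * N h"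
      by (simp only: g_def)
  qed
  obtain x where x: "0 < x" "D * x powr (- 1 / W) = 1 / 2" using log_gain_ex[OF D W] by blast
  define a where "a = exp (- x)"
  have a: "0 < a" "a < 1" using x by (auto simp: a_def)
  \<comment> \<open>The factor 1/2 equals a^(ln 2 / x), which lowers the exponent by ln 2 / x; the
    maximum with \<gamma>/2 keeps \<alpha> positive.\<close>
  define \<alpha> where "\<alpha> = max (\<gamma> / 2) (\<gamma> - ln 2 / x)"
  have \<alpha>: "0 < \<alpha>" "\<alpha> < \<gamma>" using \<gamma> x by (auto simp: \<alpha>_def)
  have lna: "ln (1 / a) = x" by (simp add: a_def ln_div)
  have "D * (1 / (a powr \<gamma> * ln (1 / a) powr (1 / W))) = (D * x powr (- 1 / W)) * a powr (- \<gamma>)"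
    by (simp add: lna powr_minus_divide)
  also have "\<dots> = exp (\<gamma> * x - ln 2)" unfolding x(2) by (simp add: a_def powr_def exp_diff)
  also have "\<dots> \<le> exp (\<alpha> * x)"
  proof -
    have "(\<gamma> - ln 2 / x) * x \<le> \<alpha> * x" using x by (intro mult_right_mono) (auto simp: \<alpha>_def)
    then show ?thesis using x by (simp add: left_diff_distrib)
  qed
  also have "\<dots> = a powr (- \<alpha>)" by (simp add: a_def powr_def)
  finally have "dilation_bound a (a powr (- \<alpha>))" using dilation_bound_mono[OF main[OF a] a(1) order_refl] by blast
  then show ?thesis using dilation_bound_all_small[OF a \<alpha>(1)] \<alpha> by blast
qed

end

section \<open>Lower estimates, and the dual argument for the operator over (t,L)\<close>

context ri_setting
begin

text \<open>On the interval \<open>h\<close> is the dilation by 1/2 of its dilation by 2, and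
  dilation by 1/2 is bounded. This undoes the shift caused by integrating to the right of
  \<open>t\<close>.\<close>

lemma N_le_dilate_2: "\<exists>K>0. \<forall>h. rcdec L h \<longrightarrow> N h \<le> ennreal K * N (\<lambda>t. h (2 * t))"
proof -
  obtain K where K: "K > 0" "dilation_bound (1 / 2) K" using dilation_bound_half by blast
  have "N h \<le> ennreal K * N (\<lambda>t. h (2 * t))" if h: "rcdec L h" for h
  proof -
    have d: "rcdec L (dilate L 2 h)" by (rule rcdec_dilate[OF h]) simp
    have "N h = N (\<lambda>t. dilate L 2 h (1 / 2 * t))"
    proof (rule N_cong[OF rcdec_scaled_measurable[OF d]])
      fix t assume t: "t \<in> dom L"
      then have "1 / 2 * t \<in> dom L" using dom_pos[OF t] by (intro dom_mono[OF t]) auto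
      then show "h t = dilate L 2 h (1 / 2 * t)" by (simp add: dilate_def)
    qed simp
    also have "\<dots> \<le> ennreal K * N (dilate L 2 h)" using K d by (simp add: dilation_bound_def)
    finally show ?thesis using N_dilate[OF h] by simp
  qed
  then show ?thesis using K by blast
qed

text \<open>On (st, 2st) a non-increasing \<open>h\<close> is bounded below by its value at the
  right end; this is where the factor 2 is lost. If that end is outside the interval, the left-hand
  side is 0.\<close>

lemma hardy_beyond_ge:
  assumes W: "0 < W" and \<gamma>: "0 \<le> \<gamma>" and h: "rcdec L h" and t: "t \<in> dom L" and s: "1 \<le> s"
  shows "ennreal (ln 2 powr (1 / W)) * (ennreal (s powr \<gamma>) * h (s * (2 * t))) \<le> hardy (beyond L) \<gamma> W h t"
proof (cases "s * (2 * t) \<in> dom L")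
  case True
  have t0: "0 < t" using t by (rule dom_pos)
  have st: "0 < s * t" "t \<le> s * t" using s t0 by (auto simp: mult_le_cancel_right1)
  have "ennreal ((s * t / t) powr \<gamma> * ln (2 * (s * t) / (s * t)) powr (1 / W)) * h (2 * (s * t)) \<le> hardy (beyond L) \<gamma> W h t"
  proof (rule hardy_ge[OF W _ _ _ t0])
    fix v assume v: "s * t < v" "v < 2 * (s * t)"
    have "ennreal ((s * t / v) powr \<gamma>) * h (2 * (s * t)) \<le> ennreal 1 * h (2 * (s * t))"
      using v st \<gamma> by (intro mult_right_mono ennreal_leI powr_le1) auto
    also have "\<dots> \<le> h v" using v st by (auto intro: rcdec_antimono[OF h])
    finally show "ennreal ((s * t / v) powr \<gamma>) * h (2 * (s * t)) \<le> h v" .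
  next
    have "v \<in> dom L" if "s * t < v" "v < 2 * (s * t)" for v
      using that st by (intro dom_mono[OF True]) auto
    then show "{s * t<..<2 * (s * t)} \<subseteq> beyond L t" using st by (auto simp: dom_def)
  qed (use st in auto)
  moreover have eq: "(s * t / t) powr \<gamma> * ln (2 * (s * t) / (s * t)) powr (1 / W) = ln 2 powr (1 / W) * s powr \<gamma>"
    using s t0 by simp
  moreover have "2 * (s * t) = s * (2 * t)" by simp
  ultimately have "ennreal (ln 2 powr (1 / W) * s powr \<gamma>) * h (s * (2 * t)) \<le> hardy (beyond L) \<gamma> W h t"
    by metis
  then show ?thesis by (simp add: ennreal_mult mult.assoc)
next
  case False
  have "0 < s * (2 * t)" using s dom_pos[OF t] by simp
  then show ?thesis using rcdec_outside[OF h _ False] by simp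
qed

text \<open>On (t/2, t) the values of \<open>h\<close> are at least \<open>h t\<close>, so the
  estimate is pointwise and holds whatever the Boyd indices are.\<close>

lemma N_le_hardy_upto:
  assumes W: "0 < W" and \<gamma>: "0 < \<gamma>"
  shows "\<exists>K>0. \<forall>h. rcdec L h \<longrightarrow> N h \<le> ennreal K * N (hardy upto \<gamma> W h)"
proof -
  define k where "k = (1 / 2) powr \<gamma> * ln 2 powr (1 / W)"
  have k: "0 < k" by (simp add: k_def)
  have "N h \<le> ennreal (1 / k) * N (hardy upto \<gamma> W h)" if h: "rcdec L h" for h
  proof (rule N_le_cmult[OF rcdec_measurable[OF h] hardy_upto_measurable[OF W]])
    fix t assume "t \<in> dom L"
    then have t0: "0 < t" by (rule dom_pos)
    have "ennreal ((t / 2 / t) powr \<gamma> * ln (t / (t / 2)) powr (1 / W)) * h t \<le> hardy upto \<gamma> W h t"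
    proof (rule hardy_ge[OF W _ _ _ t0])
      fix v assume v: "t / 2 < v" "v < t"
      have "ennreal ((t / 2 / v) powr \<gamma>) * h t \<le> ennreal 1 * h t"
        using v t0 \<gamma> by (intro mult_right_mono ennreal_leI powr_le1) auto
      also have "\<dots> \<le> h v" using v t0 by (auto intro: rcdec_antimono[OF h])
      finally show "ennreal ((t / 2 / v) powr \<gamma>) * h t \<le> h v" .
    qed (use t0 in auto)
    moreover have "(t / 2 / t) powr \<gamma> * ln (t / (t / 2)) powr (1 / W) = k" using t0 by (simp add: k_def)
    ultimately show "h t \<le> ennreal (1 / k) * hardy upto \<gamma> W h t" by (intro ennreal_le_divideI k) simp
  qed (use k in simp)
  then show ?thesis using k by (intro exI[of _ "1 / k"]) auto
qed

text \<open>Pointwise the operator only dominates h(2t); \<open>N_le_dilate_2\<close> then removes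
  the factor 2.\<close>

lemma N_le_hardy_beyond:
  assumes W: "0 < W" and \<gamma>: "0 \<le> \<gamma>"
  shows "\<exists>K>0. \<forall>h. rcdec L h \<longrightarrow> N h \<le> ennreal K * N (hardy (beyond L) \<gamma> W h)"
proof -
  obtain K1 where K1: "K1 > 0" "\<And>h. rcdec L h \<Longrightarrow> N h \<le> ennreal K1 * N (\<lambda>t. h (2 * t))"
    using N_le_dilate_2 by blast
  define k where "k = ln (2 :: real) powr (1 / W)"
  have k: "0 < k" by (simp add: k_def)
  have "N h \<le> ennreal (K1 * (1 / k)) * N (hardy (beyond L) \<gamma> W h)" if h: "rcdec L h" for h
  proof -
    have "N (\<lambda>t. h (2 * t)) \<le> ennreal (1 / k) * N (hardy (beyond L) \<gamma> W h)"
      using hardy_beyond_ge[OF W \<gamma> h, of _ 1] k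
      by (intro N_le_cmult rcdec_scaled_measurable h hardy_beyond_measurable W ennreal_le_divideI)
        (auto simp: k_def)
    then have "ennreal K1 * N (\<lambda>t. h (2 * t)) \<le> ennreal K1 * (ennreal (1 / k) * N (hardy (beyond L) \<gamma> W h))"
      by (rule mult_left_mono) simp
    with K1(2)[OF h] show ?thesis using K1(1) k by (simp add: ennreal_mult mult.assoc del: times_divide_eq_right)
  qed
  then show ?thesis using K1 k by (intro exI[of _ "K1 * (1 / k)"]) auto
qed

text \<open>Dual to \<open>dilation_bound_of_hardy_upto\<close>: the maximal function
  \<open>T\<close> runs over factors s \<ge> 1. The Hardy operator dominates it only at
  \<open>2 * t\<close>, which costs the constant \<open>K1\<close>.\<close>

lemma dilation_bound_of_hardy_beyond:
  assumes W: "0 < W" and \<gamma>: "0 \<le> \<gamma>" and K: "0 < K"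
    and b: "\<And>h. rcdec L h \<Longrightarrow> N (hardy (beyond L) \<gamma> W h) \<le> ennreal K * N h"
  shows "\<exists>\<alpha>>\<gamma>. \<exists>c>0. \<forall>a\<ge>1. dilation_bound a (c * a powr (- \<alpha>))"
proof -
  obtain K1 where K1: "K1 > 0" "\<And>h. rcdec L h \<Longrightarrow> N h \<le> ennreal K1 * N (\<lambda>t. h (2 * t))"
    using N_le_dilate_2 by blast
  define k where "k = ln (2 :: real) powr (1 / W)"
  have k: "0 < k" by (simp add: k_def)
  define D where "D = K * (K1 * (1 / k * K))"
  have D: "0 < D" using K k K1 by (simp add: D_def)
  have main: "dilation_bound a (D * (1 / (a powr \<gamma> * ln a powr (1 / W))))" if a: "1 < a" for a
    unfolding dilation_bound_def
  proof (intro allI impI)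
    fix h assume h: "rcdec L h"
    define T where "T = (\<lambda>t. SUP s\<in>{1..}. ennreal (s powr \<gamma>) * dilate L s h t)"
    have T: "rcdec L T" unfolding T_def by (intro rcdec_SUP rcdec_cmult rcdec_dilate h) auto
    have T_le: "T (2 * t) \<le> ennreal (1 / k) * hardy (beyond L) \<gamma> W h t" if t: "t \<in> dom L" for t
      unfolding T_def
    proof (intro SUP_least ennreal_le_divideI k)
      fix s :: real assume "s \<in> {1..}"
      then have s: "1 \<le> s" by simp
      have "ennreal k * (ennreal (s powr \<gamma>) * dilate L s h (2 * t)) \<le> ennreal k * (ennreal (s powr \<gamma>) * h (s * (2 * t)))"
        by (intro mult_left_mono) (auto simp: dilate_def)
      also have "\<dots> \<le> hardy (beyond L) \<gamma> W h t" unfolding k_def by (rule hardy_beyond_ge[OF W \<gamma> h t s])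
      finally show "ennreal k * (ennreal (s powr \<gamma>) * dilate L s h (2 * t)) \<le> hardy (beyond L) \<gamma> W h t" .
    qed
    have "N (\<lambda>t. T (2 * t)) \<le> ennreal (1 / k) * N (hardy (beyond L) \<gamma> W h)"
      using k T_le by (intro N_le_cmult rcdec_scaled_measurable T hardy_beyond_measurable W) auto
    also have "\<dots> \<le> ennreal (1 / k) * (ennreal K * N h)" by (intro mult_left_mono b h) simp
    finally have "ennreal K1 * N (\<lambda>t. T (2 * t)) \<le> ennreal K1 * (ennreal (1 / k) * (ennreal K * N h))"
      by (rule mult_left_mono) simp
    with K1(2)[OF T] have NT: "N T \<le> ennreal (K1 * (1 / k * K)) * N h"
      using K k K1(1) by (simp add: ennreal_mult mult.assoc del: times_divide_eq_left)
    define g where "g = a powr \<gamma> * ln a powr (1 / W)"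
    have g: "0 < g" using a by (simp add: g_def)
    have "N (\<lambda>t. h (a * t)) \<le> ennreal (1 / g) * N (hardy (beyond L) \<gamma> W T)"
    proof (rule N_le_cmult[OF rcdec_scaled_measurable[OF h] hardy_beyond_measurable[OF W]])
      fix t assume t: "t \<in> dom L"
      have t0: "0 < t" using t by (rule dom_pos)
      have at: "t < a * t" using t0 a by simp
      show "h (a * t) \<le> ennreal (1 / g) * hardy (beyond L) \<gamma> W T t"
      proof (cases "a * t \<in> dom L")
        case False
        then show ?thesis using rcdec_outside[OF h _ False] t0 at by simp
      next
        case True
        have "ennreal ((t / t) powr \<gamma> * ln (a * t / t) powr (1 / W)) * (ennreal (a powr \<gamma>) * h (a * t)) \<le> hardy (beyond L) \<gamma> W T t"
        proof (rule hardy_ge[OF W t0 at _ t0])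
          fix v assume v: "t < v" "v < a * t"
          have v0: "0 < v" using v t0 by linarith
          have vd: "v \<in> dom L" using v v0 by (intro dom_mono[OF True]) auto
          \<comment> \<open>The choice s = at/v > 1 in the supremum gives the critical profile on
            (t, at), of logarithmic length ln a.\<close>
          have "ennreal ((t / v) powr \<gamma>) * (ennreal (a powr \<gamma>) * h (a * t)) = ennreal ((a * t / v) powr \<gamma>) * dilate L (a * t / v) h v"
          proof -
            have "a * t / v = (t / v) * a" by simp
            then have "(a * t / v) powr \<gamma> = (t / v) powr \<gamma> * a powr \<gamma>"
              by (simp only: powr_mult)
            then show ?thesis
              using vd v0 by (simp add: dilate_def ennreal_mult mult.assoc)
          qed
          also have "\<dots> \<le> T v" unfolding T_def using v v0 by (intro SUP_upper) auto
          finally show "ennreal ((t / v) powr \<gamma>) * (ennreal (a powr \<gamma>) * h (a * t)) \<le> T v" .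
        next
          have "v \<in> dom L" if "t < v" "v < a * t" for v
            using that t0 by (intro dom_mono[OF True]) auto
          then show "{t<..<a * t} \<subseteq> beyond L t" by (auto simp: dom_def)
        qed
        moreover have "ennreal ((t / t) powr \<gamma> * ln (a * t / t) powr (1 / W)) * (ennreal (a powr \<gamma>) * h (a * t)) = ennreal g * h (a * t)"
          using t0 by (simp add: g_def mult.assoc[symmetric] ennreal_mult[symmetric] mult.commute)
        ultimately show ?thesis using g by (intro ennreal_le_divideI) auto
      qed
    qed (use g a in auto)
    also have "\<dots> \<le> ennreal (1 / g) * (ennreal K * N T)" by (intro mult_left_mono b T) simp
    also have "\<dots> \<le> ennreal (1 / g) * (ennreal K * (ennreal (K1 * (1 / k * K)) * N h))"
      by (intro mult_left_mono NT) auto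
    also have "\<dots> = ennreal (D * (1 / g)) * N h"
    proof -
      have "D * (1 / g) = 1 / g * (K * (K1 * (1 / k * K)))" by (simp add: D_def)
      then show ?thesis using K k g K1(1) by (simp only: ennreal_mult mult.assoc less_imp_le zero_less_divide_1_iff mult_nonneg_nonneg zero_le_divide_1_iff)
    qed
    finally show "N (\<lambda>t. h (a * t)) \<le> ennreal (D * (1 / (a powr \<gamma> * ln a powr (1 / W)))) * N h"
      by (simp only: g_def)
  qed
  obtain x where x: "0 < x" "D * x powr (- 1 / W) = 1 / 2" using log_gain_ex[OF D W] by blast
  define a where "a = exp x"
  have a: "1 < a" using x by (auto simp: a_def)
  \<comment> \<open>The factor 1/2 equals a^(-ln 2 / x), so the whole gain goes into the
    exponent.\<close>
  define \<alpha> where "\<alpha> = \<gamma> + ln 2 / x"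
  have \<alpha>: "\<gamma> < \<alpha>" "0 < \<alpha>" using \<gamma> x by (auto simp: \<alpha>_def add_nonneg_pos)
  have lna: "ln a = x" by (simp add: a_def)
  have "D * (1 / (a powr \<gamma> * ln a powr (1 / W))) = (D * x powr (- 1 / W)) * a powr (- \<gamma>)"
    by (simp add: lna powr_minus_divide)
  also have "\<dots> = exp (- (\<gamma> * x) - ln 2)" unfolding x(2) by (simp add: a_def powr_def exp_diff)
  also have "\<dots> = a powr (- \<alpha>)" using x by (simp add: a_def powr_def \<alpha>_def algebra_simps)
  finally have "dilation_bound a (a powr (- \<alpha>))" using main[OF a] by simp
  then show ?thesis using dilation_bound_all_large[OF a \<alpha>(2)] \<alpha> by blast
qed

end

section \<open>Boyd indices and equivalence of norms\<close>

context function_qn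
begin

text \<open>A supremum strictly above U means that some admissible p exceeds U; then \<alpha> = 1/p.
  Positivity of \<alpha> makes p = 1/\<alpha> a positive real in the converse direction.\<close>

lemma boyd_p_gt_iff:
  assumes U: "0 < U"
  shows "ennreal U < boyd_p L \<rho> \<longleftrightarrow>
    (\<exists>\<alpha>>0. \<alpha> < 1 / U \<and> (\<exists>c>0. \<forall>a. 0 < a \<and> a < 1 \<longrightarrow> dilation_bound a (c * a powr (- \<alpha>))))"
    (is "_ \<longleftrightarrow> ?R")
proof -
  let ?P = "\<lambda>p. \<exists>c>0. \<forall>a. 0 < a \<and> a < 1 \<longrightarrow> dil_norm L \<rho> a \<le> ennreal (c * a powr (- 1 / p))"
  have P: "?P p \<longleftrightarrow> (\<exists>c>0. \<forall>a. 0 < a \<and> a < 1 \<longrightarrow> dilation_bound a (c * a powr (- (1 / p))))" for p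
    by (intro ex_cong conj_cong refl all_cong imp_cong) (auto simp: dil_norm_le_iff)
  have "ennreal U < boyd_p L \<rho> \<longleftrightarrow> (\<exists>p. 0 < p \<and> ennreal U < ennreal p \<and> ?P p)"
    unfolding boyd_p_def less_Sup_iff by blast
  also have "\<dots> \<longleftrightarrow> (\<exists>p. 0 < p \<and> U < p \<and> ?P p)"
    using U by (simp add: ennreal_less_iff)
  also have "\<dots> \<longleftrightarrow> ?R"
  proof
    assume "\<exists>p. 0 < p \<and> U < p \<and> ?P p"
    then obtain p where p: "0 < p" "U < p" "?P p" by blast
    then show ?R using U unfolding P by (intro exI[of _ "1 / p"]) (auto simp: field_simps)
  next
    assume ?R
    then obtain \<alpha> where \<alpha>: "0 < \<alpha>" "\<alpha> < 1 / U"
      "\<exists>c>0. \<forall>a. 0 < a \<and> a < 1 \<longrightarrow> dilation_bound a (c * a powr (- \<alpha>))" by blast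
    have "1 / (1 / \<alpha>) = \<alpha>" by simp
    then show "\<exists>p. 0 < p \<and> U < p \<and> ?P p"
      unfolding P using \<alpha> U by (intro exI[of _ "1 / \<alpha>"]) (auto simp: field_simps)
  qed
  finally show ?thesis .
qed

text \<open>This includes infinite \<open>V\<close>, where \<open>enn2real (1 / V)\<close> is 0 and
  both sides hold.\<close>

lemma less_iff_enn2real_inverse:
  assumes "0 < V" "0 < q" shows "ennreal q < V \<longleftrightarrow> enn2real (1 / V) < 1 / q"
proof (cases V)
  case (real v)
  then have v: "0 < v" using assms by simp
  have "1 / V = ennreal (1 / v)" using v real divide_ennreal[of 1 v] by simp
  then show ?thesis using real v assms by (simp add: ennreal_less_iff field_simps)
qed (use assms in simp)

lemma boyd_q_less_iff:
  assumes V: "0 < V"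
  shows "boyd_q L \<rho> < V \<longleftrightarrow>
    (\<exists>\<alpha>>enn2real (1 / V). \<exists>c>0. \<forall>a\<ge>1. dilation_bound a (c * a powr (- \<alpha>)))"
    (is "_ \<longleftrightarrow> ?R")
proof -
  let ?P = "\<lambda>q. \<exists>c>0. \<forall>a\<ge>1. dil_norm L \<rho> a \<le> ennreal (c * a powr (- 1 / q))"
  have P: "?P q \<longleftrightarrow> (\<exists>c>0. \<forall>a\<ge>1. dilation_bound a (c * a powr (- (1 / q))))" for q
    by (intro ex_cong conj_cong refl all_cong imp_cong) (auto simp: dil_norm_le_iff)
  have "boyd_q L \<rho> < V \<longleftrightarrow> (\<exists>q. 0 < q \<and> ennreal q < V \<and> ?P q)"
    unfolding boyd_q_def Inf_less_iff by auto
  also have "\<dots> \<longleftrightarrow> ?R"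
  proof
    assume "\<exists>q. 0 < q \<and> ennreal q < V \<and> ?P q"
    then obtain q where q: "0 < q" "ennreal q < V" "?P q" by blast
    then show ?R using less_iff_enn2real_inverse[OF V q(1)] unfolding P
      by (intro exI[of _ "1 / q"]) simp
  next
    assume ?R
    then obtain \<alpha> where \<alpha>: "enn2real (1 / V) < \<alpha>"
      "\<exists>c>0. \<forall>a\<ge>1. dilation_bound a (c * a powr (- \<alpha>))" by blast
    have "0 < \<alpha>" using \<alpha>(1) enn2real_nonneg[of "1 / V"] by linarith
    then show "\<exists>q. 0 < q \<and> ennreal q < V \<and> ?P q"
      unfolding P using \<alpha> less_iff_enn2real_inverse[OF V, of "1 / \<alpha>"] by (intro exI[of _ "1 / \<alpha>"]) simp
  qed
  finally show ?thesis .
qed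

text \<open>One half of the equivalence is \<open>ge\<close>, so only boundedness of \<Phi> matters.
  An \<open>h\<close> of infinite norm is trivial; any other is finite on the interval and is the
  rearrangement of \<open>realize h\<close>, but only at positive arguments, hence the form of
  \<open>cong\<close>.\<close>

lemma norm_equiv_iff_bounded:
  assumes ge: "\<exists>K>0. \<forall>h. rcdec L h \<longrightarrow> N h \<le> ennreal K * N (\<Phi> h)"
    and m: "\<And>h. \<Phi> h \<in> borel_measurable M"
    and cong: "\<And>h h' t. (\<And>u. 0 < u \<Longrightarrow> h u = h' u) \<Longrightarrow> t \<in> dom L \<Longrightarrow> \<Phi> h t = \<Phi> h' t"
    and G: "\<And>f t. f \<in> Mfun L \<Longrightarrow> t \<in> dom L \<Longrightarrow> G f t = \<Phi> (rearr L f) t"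
  shows "norm_equiv L (E_norm L \<rho>) (\<lambda>f. N (G f)) \<longleftrightarrow>
    (\<exists>K>0. \<forall>h. rcdec L h \<longrightarrow> N (\<Phi> h) \<le> ennreal K * N h)"
proof -
  have GN: "N (G f) = N (\<Phi> (rearr L f))" if "f \<in> Mfun L" for f
    using G[OF that] m by (intro N_cong) auto
  show ?thesis
  proof
    assume "norm_equiv L (E_norm L \<rho>) (\<lambda>f. N (G f))"
    then obtain c where c: "0 < c" "\<And>f. f \<in> Mfun L \<Longrightarrow> ennreal c * N (G f) \<le> E_norm L \<rho> f"
      unfolding norm_equiv_def by blast
    have "N (\<Phi> h) \<le> ennreal (1 / c) * N h" if h: "rcdec L h" for h
    proof (cases "N h < \<infinity>")
      case False
      then have "N h = top" by (simp add: less_top[symmetric])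
      then show ?thesis using c(1) by (simp add: ennreal_mult_top)
    next
      case True
      have fin: "\<And>x. x \<in> dom L \<Longrightarrow> h x < \<infinity>" using rcdec_finite[OF h True] .
      have R: "realize h \<in> Mfun L" by (intro realize_Mfun rcdec_measurable h)
      have "N (\<Phi> h) = N (\<Phi> (rearr L (realize h)))"
        using cong[of h "rearr L (realize h)"] rearr_realize[OF h fin] m by (intro N_cong) auto
      then show ?thesis
        using c(2)[OF R] c(1) by (intro ennreal_le_divideI) (simp_all add: GN[OF R] E_norm_realize[OF h fin])
    qed
    then show "\<exists>K>0. \<forall>h. rcdec L h \<longrightarrow> N (\<Phi> h) \<le> ennreal K * N h"
      using c(1) by (intro exI[of _ "1 / c"]) auto
  next
    assume "\<exists>K>0. \<forall>h. rcdec L h \<longrightarrow> N (\<Phi> h) \<le> ennreal K * N h"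
    then obtain K where K: "0 < K" "\<And>h. rcdec L h \<Longrightarrow> N (\<Phi> h) \<le> ennreal K * N h" by blast
    obtain K' where K': "0 < K'" "\<And>h. rcdec L h \<Longrightarrow> N h \<le> ennreal K' * N (\<Phi> h)" using ge by blast
    show "norm_equiv L (E_norm L \<rho>) (\<lambda>f. N (G f))"
      unfolding norm_equiv_def
    \<comment> \<open>The maximum enforces the ordering of the two constants that
      \<open>norm_equiv\<close> demands.\<close>
    proof (rule exI[of _ "1 / K"], rule exI[of _ "max (1 / K) K'"], intro conjI ballI)
      fix f assume f: "f \<in> Mfun L"
      note r = rcdec_rearr[OF f]
      have "ennreal (1 / K) * N (\<Phi> (rearr L f)) \<le> ennreal (1 / K) * (ennreal K * N (rearr L f))"
        by (intro mult_left_mono K r) simp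
      then show "ennreal (1 / K) * N (G f) \<le> E_norm L \<rho> f"
        using K(1) by (simp add: GN[OF f] E_norm_def mult.assoc[symmetric] ennreal_mult[symmetric])
      have "N (rearr L f) \<le> ennreal K' * N (\<Phi> (rearr L f))" by (rule K'(2)[OF r])
      also have "\<dots> \<le> ennreal (max (1 / K) K') * N (\<Phi> (rearr L f))"
        by (intro mult_right_mono ennreal_leI) auto
      finally show "E_norm L \<rho> f \<le> ennreal (max (1 / K) K') * N (G f)" by (simp add: GN[OF f] E_norm_def)
    qed (use K in auto)
  qed
qed

end

section \<open>The averaging operators as instances of the Hardy operator\<close>

lemma hardy_cong:
  assumes "A t \<subseteq> {0<..}" "\<And>u. 0 < u \<Longrightarrow> h u = h' u"
  shows "hardy A \<gamma> W h t = hardy A \<gamma> W h' t"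
  unfolding hardy_def using assms by (intro arg_cong2[where f = "(*)"] refl Lq_norm_cong) auto

lemma H_upper_eq_hardy: "H_upper L U W f t = hardy upto (1 / U) W (rearr L f) t"
  by (simp add: H_upper_def hardy_def)

lemma H_lower_eq_hardy: "H_lower L V W f t = hardy (beyond L) (enn2real (1 / V)) W (rearr L f) t"
  by (simp add: H_lower_def hardy_def)

text \<open>For W = U the weight is v^0 = 1 on (0,t).\<close>

lemma maximal_fn_pow_eq_hardy:
  assumes "0 < U" "0 < t"
  shows "maximal_fn_pow L U f t = hardy upto (1 / U) U (rearr L f) t"
proof -
  have "Lq_norm U (upto t) (\<lambda>v. ennreal (v powr (1 / U - 1 / U)) * rearr L f v) = Lq_norm U (upto t) (rearr L f)"
    by (rule Lq_norm_cong) auto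
  then show ?thesis
    using assms by (simp add: maximal_fn_pow_def hardy_def Lq_norm_def epowr_mult epowr_ennreal
        powr_divide powr_minus_divide)
qed

lemma maximal_fn_eq_pow: "maximal_fn L f t = maximal_fn_pow L 1 f t"
  by (simp add: maximal_fn_def maximal_fn_pow_def epowr_1)

text \<open>The case V = W = 1. The integral may run to infinity because the rearrangement vanishes
  beyond \<open>L\<close>.\<close>

lemma tail_mean_eq_hardy:
  assumes f: "f \<in> Mfun L" and t: "0 < t"
  shows "ennreal (1 / t) * (\<integral>\<^sup>+s\<in>{t<..}. rearr L f s \<partial>lebesgue) = hardy (beyond L) 1 1 (rearr L f) t"
proof -
  have "Lq_norm 1 (beyond L t) (\<lambda>v. ennreal (v powr (1 - 1 / 1)) * rearr L f v) = Lq_norm 1 (beyond L t) (rearr L f)"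
    using t by (intro Lq_norm_cong) auto
  also have "\<dots> = (\<integral>\<^sup>+s\<in>{t<..}. rearr L f s \<partial>lebesgue)"
    using rcdec_outside[OF rcdec_rearr[OF f]] t
    by (auto simp: Lq_norm_def epowr_1 indicator_def dom_def intro!: nn_integral_cong)
  finally show ?thesis using t by (simp add: hardy_def powr_minus_divide)
qed

context ri_setting
begin

text \<open>\<open>G\<close> need only agree with the operator on the interval, so that
  \<open>H_upper\<close> and both maximal functions become instances.\<close>

lemma norm_equiv_hardy_upto:
  assumes W: "0 < W" and U: "0 < U"
    and G: "\<And>f t. f \<in> Mfun L \<Longrightarrow> t \<in> dom L \<Longrightarrow> G f t = hardy upto (1 / U) W (rearr L f) t"
  shows "norm_equiv L (E_norm L \<rho>) (\<lambda>f. N (G f)) \<longleftrightarrow> ennreal U < boyd_p L \<rho>"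
proof -
  have \<gamma>: "0 < 1 / U" using U by simp
  have "norm_equiv L (E_norm L \<rho>) (\<lambda>f. N (G f)) \<longleftrightarrow>
      (\<exists>K>0. \<forall>h. rcdec L h \<longrightarrow> N (hardy upto (1 / U) W h) \<le> ennreal K * N h)"
    by (rule norm_equiv_iff_bounded[OF N_le_hardy_upto[OF W \<gamma>] hardy_upto_measurable[OF W] hardy_cong G]) auto
  also have "\<dots> \<longleftrightarrow> ennreal U < boyd_p L \<rho>"
    unfolding boyd_p_gt_iff[OF U]
    using dilation_bound_of_hardy_upto[OF W \<gamma>] hardy_upto_bounded[OF W, where \<gamma> = "1 / U"] by blast
  finally show ?thesis .
qed

lemma norm_equiv_hardy_beyond:
  assumes W: "0 < W" and V: "0 < V"
    and G: "\<And>f t. f \<in> Mfun L \<Longrightarrow> t \<in> dom L \<Longrightarrow> G f t = hardy (beyond L) (enn2real (1 / V)) W (rearr L f) t"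
  shows "norm_equiv L (E_norm L \<rho>) (\<lambda>f. N (G f)) \<longleftrightarrow> boyd_q L \<rho> < V"
proof -
  let ?\<gamma> = "enn2real (1 / V)"
  have \<gamma>: "0 \<le> ?\<gamma>" by simp
  have "norm_equiv L (E_norm L \<rho>) (\<lambda>f. N (G f)) \<longleftrightarrow>
      (\<exists>K>0. \<forall>h. rcdec L h \<longrightarrow> N (hardy (beyond L) ?\<gamma> W h) \<le> ennreal K * N h)"
    by (rule norm_equiv_iff_bounded[OF N_le_hardy_beyond[OF W \<gamma>] hardy_beyond_measurable[OF W] hardy_cong G])
      (auto dest: dom_pos)
  also have "\<dots> \<longleftrightarrow> boyd_q L \<rho> < V"
    unfolding boyd_q_less_iff[OF V]
    using dilation_bound_of_hardy_beyond[OF W \<gamma>] hardy_beyond_bounded[OF W \<gamma>] by blast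
  finally show ?thesis .
qed

end

theorem theorem23:
  fixes L :: ennreal
    and \<rho> :: "(real \<Rightarrow> ennreal) \<Rightarrow> ennreal"
    and W :: real
  assumes "L = 1 \<or> L = \<infinity>"
    and "function_quasi_norm L \<rho>"
    and "E_quasi_norm L \<rho>"
    and "0 < W"
  shows
    "(\<forall>U::real. 0 < U \<longrightarrow>
        (norm_equiv L (E_norm L \<rho>) (\<lambda>f. B_norm L \<rho> (H_upper L U W f)) \<longleftrightarrow> boyd_p L \<rho> > ennreal U) \<and>
        (norm_equiv L (E_norm L \<rho>) (\<lambda>f. B_norm L \<rho> (maximal_fn_pow L U f)) \<longleftrightarrow> boyd_p L \<rho> > ennreal U)) \<and>
     (norm_equiv L (E_norm L \<rho>) (\<lambda>f. B_norm L \<rho> (maximal_fn L f)) \<longleftrightarrow> boyd_p L \<rho> > 1) \<and>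
     (\<forall>V::ennreal. 0 < V \<longrightarrow>
        (norm_equiv L (E_norm L \<rho>) (\<lambda>f. B_norm L \<rho> (H_lower L V W f)) \<longleftrightarrow> boyd_q L \<rho> < V)) \<and>
     (norm_equiv L (E_norm L \<rho>)
        (\<lambda>f. B_norm L \<rho> (\<lambda>t. ennreal (1 / t) * (\<integral>\<^sup>+s\<in>{t<..}. rearr L f s \<partial>lebesgue)))
        \<longleftrightarrow> boyd_q L \<rho> < 1)"
proof -
  interpret ri_setting L \<rho> using assms(2,3) by unfold_locales
  show ?thesis
  proof (intro conjI allI impI)
    fix U :: real assume U: "0 < U"
    show "norm_equiv L (E_norm L \<rho>) (\<lambda>f. N (H_upper L U W f)) \<longleftrightarrow> boyd_p L \<rho> > ennreal U"
      by (rule norm_equiv_hardy_upto[OF assms(4) U H_upper_eq_hardy])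
    show "norm_equiv L (E_norm L \<rho>) (\<lambda>f. N (maximal_fn_pow L U f)) \<longleftrightarrow> boyd_p L \<rho> > ennreal U"
      \<comment> \<open>The criterion is used with \<open>U\<close> in the place of the inner
        exponent \<open>W\<close>.\<close>
      by (rule norm_equiv_hardy_upto[OF U U maximal_fn_pow_eq_hardy[OF U dom_pos]])
  next
    show "norm_equiv L (E_norm L \<rho>) (\<lambda>f. N (maximal_fn L f)) \<longleftrightarrow> boyd_p L \<rho> > 1"
      using norm_equiv_hardy_upto[of 1 1 "maximal_fn L"]
      by (simp add: maximal_fn_eq_pow maximal_fn_pow_eq_hardy dom_pos)
  next
    fix V :: ennreal assume V: "0 < V"
    show "norm_equiv L (E_norm L \<rho>) (\<lambda>f. N (H_lower L V W f)) \<longleftrightarrow> boyd_q L \<rho> < V"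
      by (rule norm_equiv_hardy_beyond[OF assms(4) V H_lower_eq_hardy])
  next
    show "norm_equiv L (E_norm L \<rho>)
        (\<lambda>f. N (\<lambda>t. ennreal (1 / t) * (\<integral>\<^sup>+s\<in>{t<..}. rearr L f s \<partial>lebesgue))) \<longleftrightarrow> boyd_q L \<rho> < 1"
      by (rule norm_equiv_hardy_beyond[of 1]) (simp_all add: tail_mean_eq_hardy dom_pos)
  qed
qed

end
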